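(* Let $n\ge2$ and $\tau$ be positive integers and let $N$ be a real number with $N\in(D(n,\tau),D(n,\tau+1)]$. Then the space $\mathcal P_\tau$ of real polynomials of degree at most $\tau$ is a ULB-space for dimension $n$ and cardinality $N$.
   Context: $\mu$ is the probability measure on $[-1,1]$ with density proportional to $(1-t^2)^{(n-3)/2}$. $P_i^{(n)}$ is the Gegenbauer polynomial of degree $i$, orthogonal with respect to $\mu$, $P_i^{(n)}(1)=1$. For $\tau=2k-1+\varepsilon$ with $k\ge 1$ and $\varepsilon\in\{0,1\}$, $D(n,\tau):=\binom{n+k-2+\varepsilon}{n-1}+\binom{n+k-2}{n-1}$ (Delsarte–Goethals–Seidel bound). A $1/N$-quadrature rule exact for a subspace $\Lambda\subset C[-1,1]$ is a finite sequence of pairs $(\alpha_i,\rho_i)_{i=1}^m$ with $-1\le\alpha_1<\dots<\alpha_m<1$, $\rho_i>0$ and $\int f\,d\mu=\frac{f(1)}N+\sum_{i=1}^m\rho_if(\alpha_i)$ for all $f\in\Lambda$. A function $h:[-1,1]\to(0,+\infty]$ is absolutely monotone if $h^{(i)}(t)\ge0$ for all $t\in[-1,1)$ and all integers $i\ge0$, and $h(1)=\lim_{t\to1^-}h(t)$. $A_{n,h}$ is the set of continuous $f$ on $[-1,1]$ with $f(t)=\sum_{i\ge0}f_iP_i^{(n)}(t)\le h(t)$ on $[-1,1]$ and $f_i\ge0$ for all $i\ge1$. A subspace $\Lambda\subset C[-1,1]$ is a ULB-space for dimension $n$ and cardinality $N$ (the definition is used also for real $N\ge2$) if (i) there is a $1/N$-quadrature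 rule exact for $\Lambda$, and (ii) for every absolutely monotone $h$ there is $f\in\Lambda\cap A_{n,h}$ that agrees with $h$ at the nodes of the $1/N$-quadrature rule from (i). *)

theory Defs
  imports "HOL-Analysis.Analysis" "HOL-Computational_Algebra.Polynomial"
begin

definition gegenbauer_weight :: "nat \<Rightarrow> real \<Rightarrow> real" where
  "gegenbauer_weight n t = (1 - t\<^sup>2) powr ((real n - 3) / 2)"

text \<open>
  The measure lives on the restricted space, so that every function continuous on
  \<open>[-1,1]\<close> is measurable whatever its values outside that interval.
\<close>

definition gegenbauer_measure :: "nat \<Rightarrow> real measure" where
  "gegenbauer_measure n =
     density (restrict_space lborel {-1..1})
       (\<lambda>t. ennreal (gegenbauer_weight n t /
              (LINT s|restrict_space lborel {-1..1}. gegenbauer_weight n s)))"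

text \<open>
  The conditions determine the sequence of polynomials uniquely when \<open>n \<ge> 2\<close>.
\<close>

definition gegenbauer :: "nat \<Rightarrow> nat \<Rightarrow> real poly" where
  "gegenbauer n =
     (THE P. (\<forall>i. degree (P i) = i \<and> poly (P i) 1 = 1) \<and>
             (\<forall>i j. i \<noteq> j \<longrightarrow>
                (LINT t|gegenbauer_measure n. poly (P i) t * poly (P j) t) = 0))"

text \<open>
  The Delsarte--Goethals--Seidel bound: for \<open>\<tau> = 2 k - 1 + \<epsilon>\<close> with \<open>k \<ge> 1\<close> and
  \<open>\<epsilon> \<in> {0, 1}\<close> one has \<open>\<tau> + 1 = 2 k + \<epsilon>\<close>, which gives \<open>k\<close> and \<open>\<epsilon>\<close> below.
  The subtractions do not truncate for \<open>n \<ge> 2\<close>.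
\<close>

definition DGS_bound :: "nat \<Rightarrow> nat \<Rightarrow> nat" where
  "DGS_bound n \<tau> =
     (let k = (\<tau> + 1) div 2; \<epsilon> = (\<tau> + 1) mod 2
      in ((n + k - 2 + \<epsilon>) choose (n - 1)) + ((n + k - 2) choose (n - 1)))"

text \<open>
  Elements of \<open>C[-1,1]\<close> are represented by functions on the reals that are
  continuous on \<open>[-1,1]\<close>; no notion below depends on values outside \<open>[-1,1]\<close>,
  apart from membership in a given set of representatives.
\<close>

definition subspace_of_C :: "(real \<Rightarrow> real) set \<Rightarrow> bool" where
  "subspace_of_C \<Lambda> \<longleftrightarrow>
     (\<forall>f\<in>\<Lambda>. continuous_on {-1..1} f) \<and>
     (\<lambda>t. 0) \<in> \<Lambda> \<and>
     (\<forall>f\<in>\<Lambda>. \<forall>g\<in>\<Lambda>. (\<lambda>t. f t + g t) \<in> \<Lambda>) \<and>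
     (\<forall>c. \<forall>f\<in>\<Lambda>. (\<lambda>t. c * f t) \<in> \<Lambda>)"

definition poly_space :: "nat \<Rightarrow> (real \<Rightarrow> real) set" where
  "poly_space \<tau> = {poly p |p. degree p \<le> \<tau>}"

text \<open>
  A rule is the list of pairs (node, weight); the node \<open>1\<close>, which carries the
  weight \<open>1/N\<close>, is not listed.
\<close>

definition quadrature_rule ::
  "nat \<Rightarrow> real \<Rightarrow> (real \<Rightarrow> real) set \<Rightarrow> (real \<times> real) list \<Rightarrow> bool" where
  "quadrature_rule n N \<Lambda> Q \<longleftrightarrow>
     sorted_wrt (<) (map fst Q) \<and>
     (\<forall>(\<alpha>, \<rho>)\<in>set Q. -1 \<le> \<alpha> \<and> \<alpha> < 1 \<and> \<rho> > 0) \<and>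
     (\<forall>f\<in>\<Lambda>. (LINT t|gegenbauer_measure n. f t) =
              f 1 / N + (\<Sum>(\<alpha>, \<rho>)\<leftarrow>Q. \<rho> * f \<alpha>))"

text \<open>
  \<open>d i\<close> is the \<open>i\<close>-th derivative of \<open>h\<close> on \<open>[-1,1)\<close>, one-sided at \<open>-1\<close>; in particular
  \<open>h\<close> is finite on \<open>[-1,1)\<close>, while \<open>h 1 = \<infinity>\<close> is possible.
\<close>

definition absolutely_monotone :: "(real \<Rightarrow> ereal) \<Rightarrow> bool" where
  "absolutely_monotone h \<longleftrightarrow>
     (\<forall>t\<in>{-1..1}. 0 < h t) \<and>
     (\<exists>d :: nat \<Rightarrow> real \<Rightarrow> real.
        \<forall>t\<in>{-1..<1}.
          h t = ereal (d 0 t) \<and>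
          (\<forall>i. (d i has_real_derivative d (Suc i) t) (at t within {-1..<1}) \<and> 0 \<le> d i t)) \<and>
     (h \<longlongrightarrow> h 1) (at_left 1)"

text \<open>
  Pointwise convergence of the expansion on \<open>[-1,1]\<close> is already absolute and uniform:
  at \<open>t = 1\<close> it says that the coefficients are summable, and \<open>|P\<^sub>i| \<le> 1\<close> on \<open>[-1,1]\<close>.
\<close>

definition admissible :: "nat \<Rightarrow> (real \<Rightarrow> ereal) \<Rightarrow> (real \<Rightarrow> real) set" where
  "admissible n h =
     {f. continuous_on {-1..1} f \<and>
         (\<exists>c :: nat \<Rightarrow> real. (\<forall>i\<ge>1. 0 \<le> c i) \<and>
            (\<forall>t\<in>{-1..1}. (\<lambda>i. c i * poly (gegenbauer n i) t) sums f t)) \<and>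
         (\<forall>t\<in>{-1..1}. ereal (f t) \<le> h t)}"

text \<open>
  The interpolation condition concerns the nodes \<open>\<alpha> < 1\<close> only: \<open>h 1\<close> may be infinite.
  The same rule serves all potentials \<open>h\<close>.
\<close>

definition ULB_space :: "nat \<Rightarrow> real \<Rightarrow> (real \<Rightarrow> real) set \<Rightarrow> bool" where
  "ULB_space n N \<Lambda> \<longleftrightarrow>
     subspace_of_C \<Lambda> \<and>
     (\<exists>Q. quadrature_rule n N \<Lambda> Q \<and>
        (\<forall>h. absolutely_monotone h \<longrightarrow>
           (\<exists>f\<in>\<Lambda> \<inter> admissible n h. \<forall>(\<alpha>, \<rho>)\<in>set Q. ereal (f \<alpha>) = h \<alpha>)))"

end

theory Submission
  imports Defs
begin

text \<open>
  The rule is a Gauss rule for the functional \<open>\<integral> f d\<mu> - f(1)/N\<close> when \<open>\<tau> = 2k - 1\<close>, and for the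
  same functional with the weight \<open>1 + t\<close> (adding the node \<open>-1\<close>) when \<open>\<tau> = 2k\<close>. If \<open>F\<^sub>j\<close> denotes
  the reproducing kernel of the point 1 in degree \<open>j\<close>, the interior nodes are the zeros of
  \<open>F\<^sub>k + c F\<^sub>k\<^sub>-\<^sub>1\<close>. The lower bound on \<open>N\<close> gives positivity, hence positive weights and nodes
  in the interval, and the upper bound gives \<open>c \<ge> 0\<close>.

  The interpolant is the Hermite interpolant. In Newton form its coefficients are divided
  differences of an absolutely monotone function, hence nonnegative, and so is the remainder.
  By a Darboux transformation argument the partial products of the \<open>t - \<alpha>\<^sub>i\<close>, nodes taken in
  increasing order, are nonnegative combinations of the \<open>F\<^sub>j\<close>. Both kinds of kernels are
  nonnegative combinations of Gegenbauer polynomials for dimension \<open>n + 2\<close>, whose products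
  linearize with nonnegative coefficients by Askey's criterion (which does not apply
  in dimensions 2 and 3 themselves), and these expand nonnegatively in the Gegenbauer polynomials for dimension \<open>n\<close>.
\<close>

subsection \<open>Cones of polynomials\<close>

text \<open>Adding one generator at a time turns every closure property into an induction without
  index sets; \<open>pcone_range_sum\<close> recovers explicit coefficients at the end.\<close>

inductive_set pcone :: "real poly set \<Rightarrow> real poly set" for S where
  zero: "0 \<in> pcone S"
| step: "p \<in> pcone S \<Longrightarrow> q \<in> S \<Longrightarrow> 0 \<le> c \<Longrightarrow> p + smult c q \<in> pcone S"

lemma pcone_add:
  assumes "p \<in> pcone S" "q \<in> pcone S"
  shows "p + q \<in> pcone S"
  using assms(2,1) by induction (auto simp: add.assoc[symmetric] intro: pcone.step)

lemma pcone_smult: "p \<in> pcone S \<Longrightarrow> 0 \<le> c \<Longrightarrow> smult c p \<in> pcone S"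
  by (induction p rule: pcone.induct) (auto simp: smult_add_right intro: pcone.intros)

lemma pcone_base: "q \<in> S \<Longrightarrow> q \<in> pcone S"
  using pcone.step[OF pcone.zero, of q S 1] by simp

lemma pcone_sum: "(\<And>i. i \<in> I \<Longrightarrow> f i \<in> pcone S) \<Longrightarrow> (\<Sum>i\<in>I. f i) \<in> pcone S"
  by (induction I rule: infinite_finite_induct) (auto intro: pcone.zero pcone_add)

lemma pcone_trans: "p \<in> pcone S \<Longrightarrow> S \<subseteq> pcone T \<Longrightarrow> p \<in> pcone T"
  by (induction p rule: pcone.induct) (auto intro: pcone.zero pcone_add pcone_smult)

lemma pcone_mult:
  assumes "p \<in> pcone S" "q \<in> pcone T" "\<And>a b. a \<in> S \<Longrightarrow> b \<in> T \<Longrightarrow> a * b \<in> pcone U"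
  shows "p * q \<in> pcone U"
  using assms(1)
proof (induction p rule: pcone.induct)
  case (step p a c)
  have "a * q \<in> pcone U"
    using assms(2)
  proof (induction q rule: pcone.induct)
    case (step q b d)
    then show ?case
      using assms(3)[OF \<open>a \<in> S\<close> step(2)]
      by (auto simp: distrib_left intro!: pcone_add pcone_smult)
  qed (simp add: pcone.zero)
  then show ?case
    using step by (auto simp: distrib_right intro!: pcone_add pcone_smult)
qed (simp add: pcone.zero)

text \<open>Leads from cone membership back to the coefficient sequence that
  \<open>admissible\<close> asks for.\<close>

lemma pcone_range_sum:
  fixes P :: "nat \<Rightarrow> real poly"
  assumes "p \<in> pcone (range P)"
  shows "\<exists>c m. (\<forall>i. 0 \<le> c i) \<and> p = (\<Sum>i<m. smult (c i) (P i))"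
  using assms
proof (induction p rule: pcone.induct)
  case zero
  show ?case by (rule exI[of _ "\<lambda>_. 0"]) auto
next
  case (step p q a)
  then obtain c m j where c: "\<forall>i. 0 \<le> c i" "p = (\<Sum>i<m. smult (c i) (P i))" "q = P j"
    by auto
  define M where "M = max m (Suc j)"
  \<comment> \<open>A generator may recur or lie beyond the current range, so its coefficient is
    added to what is already there and the range grows to \<open>M\<close>.\<close>
  define c' where "c' = (\<lambda>i. (if i < m then c i else 0) + (if i = j then a else 0))"
  have "(\<Sum>i<M. smult (c' i) (P i)) =
      (\<Sum>i<M. if i < m then smult (c i) (P i) else 0) + (\<Sum>i<M. if i = j then smult a (P i) else 0)"
    unfolding c'_def sum.distrib[symmetric]
    by (rule sum.cong) (auto simp: smult_add_left)
  also have "(\<Sum>i<M. if i < m then smult (c i) (P i) else 0) = p"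
  proof -
    have "{..<M} \<inter> {i. i < m} = {..<m}" by (auto simp: M_def)
    then show ?thesis by (simp add: sum.If_cases c)
  qed
  also have "(\<Sum>i<M. if i = j then smult a (P i) else 0) = smult a q"
    by (simp add: c M_def)
  finally show ?case
    using c step(3) by (intro exI[of _ c'] exI[of _ M]) (auto simp: c'_def)
qed

subsection \<open>Three-term recurrences\<close>

text \<open>A finite segment of a Jacobi matrix. The recurrence is demanded only below
  \<open>n\<close>, because \<open>jacobi_change_top\<close> modifies the top polynomial and each
  Darboux step shortens the segment by one. Since \<open>C 0 = 0\<close>, the truncated index
  \<open>i - 1\<close> at \<open>i = 0\<close> is harmless.\<close>

locale jacobi =
  fixes p :: "nat \<Rightarrow> real poly" and A B C :: "nat \<Rightarrow> real" and n :: nat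
  assumes p_0: "p 0 = 1" and C_0: "C 0 = 0"
    and A_pos: "\<And>i. i < n \<Longrightarrow> 0 < A i"
    and C_pos: "\<And>i. 0 < i \<Longrightarrow> i < n \<Longrightarrow> 0 < C i"
    and rec: "\<And>i. i < n \<Longrightarrow>
      [:0, 1:] * p i = smult (A i) (p (Suc i)) + smult (B i) (p i) + smult (C i) (p (i - 1))"
begin

lemma rec_poly:
  "i < n \<Longrightarrow> x * poly (p i) x = A i * poly (p (Suc i)) x + B i * poly (p i) x + C i * poly (p (i - 1)) x"
  using arg_cong[OF rec, of i "\<lambda>q. poly q x"] by simp

lemma degree_lead_coeff:
  assumes "i \<le> n"
  shows "degree (p i) = i \<and> 0 < lead_coeff (p i)"
  using assms
proof (induction i rule: less_induct)
  case (less i)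
  show ?case
  proof (cases i)
    case (Suc j)
    have j: "degree (p j) = j" "0 < lead_coeff (p j)" "j < n"
      using less.IH[of j] less.prems Suc by auto
    have d: "degree (p (j - 1)) \<le> j"
      using less.IH[of "j - 1"] less.prems Suc by simp
    define u where "u = [:0, 1:] * p j - smult (B j) (p j) - smult (C j) (p (j - 1))"
    have "coeff u k = (if k = 0 then 0 else coeff (p j) (k - 1)) - B j * coeff (p j) k - C j * coeff (p (j - 1)) k" for k
      by (simp add: u_def coeff_pCons split: nat.split)
    then have cu: "coeff u i = lead_coeff (p j)" "\<And>k. k > i \<Longrightarrow> coeff u k = 0"
      using j d Suc by (auto simp: coeff_eq_0)
    have "degree u = i"
      using cu j(2) by (intro antisym degree_le le_degree) auto
    moreover have "p i = smult (1 / A j) u"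
      using rec[OF j(3)] A_pos[OF j(3)] Suc by (simp add: u_def algebra_simps)
    ultimately show ?thesis
      using cu j A_pos[OF j(3)] by simp
  qed (simp add: p_0)
qed

lemma lead_coeff_pos: "i \<le> n \<Longrightarrow> 0 < lead_coeff (p i)"
  using degree_lead_coeff by blast

text \<open>Interlacing: at the largest zero of \<open>p m\<close> the recurrence makes
  \<open>A m * p (Suc m)\<close> equal to \<open>- C m * p (m - 1)\<close>, which is negative there.
  As its leading coefficient is positive, \<open>p (Suc m)\<close> has a zero further right.\<close>

lemma largest_root:
  assumes "0 < m" "m \<le> n"
  shows "\<exists>r. poly (p m) r = 0 \<and> (\<forall>x>r. 0 < poly (p m) x) \<and> (\<forall>i<m. \<forall>x\<ge>r. 0 < poly (p i) x)"
  using assms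
proof (induction m)
  case (Suc m)
  show ?case
  proof (cases "m = 0")
    case True
    have 0: "poly (p (Suc 0)) x = (x - B 0) / A 0" for x
      using rec_poly[of 0 x] A_pos[of 0] Suc.prems by (simp add: p_0 C_0 True field_simps)
    show ?thesis
      using A_pos[of 0] Suc.prems by (intro exI[of _ "B 0"]) (auto simp: 0 True p_0)
  next
    case False
    then obtain r where r: "poly (p m) r = 0" "\<And>x. x > r \<Longrightarrow> 0 < poly (p m) x"
        "\<And>i x. i < m \<Longrightarrow> x \<ge> r \<Longrightarrow> 0 < poly (p i) x"
      using Suc by force
    have m: "m < n" "0 < m" using Suc.prems False by auto
    have "A m * poly (p (Suc m)) r = - C m * poly (p (m - 1)) r"
      using rec_poly[OF m(1), of r] r(1) by simp
    also have "\<dots> < 0"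
      using C_pos[OF m(2,1)] r(3)[of "m - 1" r] m by simp
    finally have neg: "poly (p (Suc m)) r < 0"
      using A_pos[OF m(1)] by (simp add: mult_less_0_iff)
    obtain b where b: "\<And>x. x \<ge> b \<Longrightarrow> lead_coeff (p (Suc m)) \<le> poly (p (Suc m)) x"
      using poly_pinfty_gt_lc[of "p (Suc m)"] degree_lead_coeff[of "Suc m"] m
      by (metis Suc_leI)
    have big: "0 < poly (p (Suc m)) x" if "x \<ge> b" for x
      using b[OF that] lead_coeff_pos[OF Suc.prems(2)] by linarith
    define Z where "Z = {x. poly (p (Suc m)) x = 0}"
    have nz: "p (Suc m) \<noteq> 0" using neg by auto
    then have fin: "finite Z" unfolding Z_def by (rule poly_roots_finite)
    have above: "\<exists>z\<in>Z. x < z" if "poly (p (Suc m)) x < 0" for x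
    proof -
      have lt: "x < max b (x + 1)" by simp
      have "0 < poly (p (Suc m)) (max b (x + 1))" by (rule big) simp
      from poly_IVT_pos[OF lt that this] show ?thesis by (auto simp: Z_def)
    qed
    have ne: "Z \<noteq> {}" using above[OF neg] by auto
    define s where "s = Max Z"
    have s: "s \<in> Z" "\<And>z. z \<in> Z \<Longrightarrow> z \<le> s"
      using fin ne by (auto simp: s_def)
    have "r < s" using above[OF neg] s(2) by force
    have beyond: "0 < poly (p (Suc m)) x" if "s < x" for x
    proof (rule ccontr)
      assume "\<not> 0 < poly (p (Suc m)) x"
      moreover have "poly (p (Suc m)) x \<noteq> 0" using s(2)[of x] that by (auto simp: Z_def)
      ultimately have "poly (p (Suc m)) x < 0" by simp
      from above[OF this] show False using s(2) that by force
    qed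
    show ?thesis
      using s(1) beyond \<open>r < s\<close> r(2,3) by (intro exI[of _ s]) (auto simp: Z_def less_Suc_eq)
  qed
qed simp

end

text \<open>
  Dividing the last polynomial by its largest linear factor is a Darboux transformation, under
  which the new family lies in the pcone of the old one and again satisfies such a recurrence.
\<close>

lemma jacobi_partial_products:
  assumes "jacobi p A B C n"
  shows "\<exists>\<alpha>. strict_mono_on {..<n} \<alpha> \<and>
    p n = smult (lead_coeff (p n)) (\<Prod>i<n. [:- \<alpha> i, 1:]) \<and>
    (\<forall>s\<le>n. (\<Prod>i<s. [:- \<alpha> i, 1:]) \<in> pcone (p ` {..n}))"
  using assms
proof (induction n arbitrary: p B C)
  case 0
  then interpret jacobi p A B C 0 .
  show ?case by (auto simp: p_0 strict_mono_on_def intro: pcone_base)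
next
  case (Suc n)
  then interpret jacobi p A B C "Suc n" by blast
  obtain r where r: "poly (p (Suc n)) r = 0" "\<And>x. x > r \<Longrightarrow> 0 < poly (p (Suc n)) x"
      "\<And>i x. i < Suc n \<Longrightarrow> x \<ge> r \<Longrightarrow> 0 < poly (p i) x"
    using largest_root[of "Suc n"] by auto
  \<comment> \<open>The recurrence at \<open>r\<close>, divided by the value of \<open>p i\<close>,
    splits \<open>r - B i\<close> into \<open>e i + d i\<close>: a triangular factorization of the
    shifted Jacobi matrix.\<close>
  define e where "e i = A i * poly (p (Suc i)) r / poly (p i) r" for i
  define d where "d i = C i * poly (p (i - 1)) r / poly (p i) r" for i
  \<comment> \<open>Up to scaling, this is the Christoffel-Darboux kernel at \<open>r\<close>. In
    this form its coefficients in the \<open>p i\<close> are visibly nonnegative.\<close>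
  define s where "s = rec_nat (p 0) (\<lambda>i q. p (Suc i) + smult (d (Suc i) / A i) q)"
  have s_0: "s 0 = 1" and s_Suc: "s (Suc i) = p (Suc i) + smult (d (Suc i) / A i) (s i)" for i
    by (simp_all add: s_def p_0)
  have d_pos: "0 < d i" if "0 < i" "i \<le> n" for i
    using that r(3)[of i r] r(3)[of "i - 1" r] C_pos[of i] by (simp add: d_def)
  have e_pos: "0 < e i" if "i < n" for i
    using that r(3)[of i r] r(3)[of "Suc i" r] A_pos[of i] by (simp add: e_def)
  \<comment> \<open>As \<open>r\<close> is a zero of the last polynomial, \<open>darboux\<close> at
    \<open>n\<close> becomes an exact division by the linear factor.\<close>
  have e_n: "e n = 0" by (simp add: e_def r)
  have d_0: "d 0 = 0" by (simp add: d_def C_0)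
  have r_rec: "r = e i + B i + d i" if "i \<le> n" for i
    using rec_poly[of i r] r(3)[of i r] that by (simp add: e_def d_def field_simps)
  have de: "d (Suc i) * e i / A i = C (Suc i)" if "Suc i \<le> n" for i
    using that r(3)[of i r] r(3)[of "Suc i" r] A_pos[of i] by (simp add: d_def e_def)
  have darboux: "[:- r, 1:] * s i = smult (A i) (p (Suc i)) - smult (e i) (p i)" if "i \<le> n" for i
    using that
  proof (induction i)
    case 0
    have "[:0, 1:] * p 0 = smult (A 0) (p 1) + smult (B 0) (p 0)"
      using rec[of 0] by (simp add: C_0)
    moreover have "[:- r, 1:] * s 0 = [:0, 1:] * p 0 - smult r (p 0)"
      by (simp add: s_0 p_0)
    moreover have "smult r (p 0) = smult (e 0) (p 0) + smult (B 0) (p 0)"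
      using r_rec[of 0] d_0 by (simp flip: smult_add_left)
    ultimately show ?case by simp
  next
    case (Suc i)
    have i: "i < Suc n" "Suc i < Suc n" using Suc by auto
    have "[:- r, 1:] * s (Suc i) = [:0, 1:] * p (Suc i) - smult r (p (Suc i))
        + smult (d (Suc i) / A i) ([:- r, 1:] * s i)"
      by (simp add: s_Suc algebra_simps smult_add_right)
    also have "\<dots> = smult (A (Suc i)) (p (Suc (Suc i))) + smult (B (Suc i)) (p (Suc i))
        + smult (C (Suc i)) (p i) - smult r (p (Suc i))
        + smult (d (Suc i) / A i) (smult (A i) (p (Suc i)) - smult (e i) (p i))"
      using Suc rec[OF i(2)] by simp
    also have "smult (d (Suc i) / A i) (smult (A i) (p (Suc i)) - smult (e i) (p i))
        = smult (d (Suc i)) (p (Suc i)) - smult (C (Suc i)) (p i)"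
      using de[of i] A_pos[OF i(1)] Suc.prems by (simp add: smult_diff_right)
    also have "smult r (p (Suc i)) = smult (e (Suc i)) (p (Suc i)) + smult (B (Suc i)) (p (Suc i))
        + smult (d (Suc i)) (p (Suc i))"
      using r_rec[of "Suc i"] Suc.prems by (simp flip: smult_add_left)
    finally show ?case by simp
  qed
  \<comment> \<open>The recurrence of \<open>s\<close> comes from multiplying the two triangular
    factors in the opposite order. The coefficients \<open>A\<close> do not change, so the induction
    keeps them fixed.\<close>
  have "jacobi s A (\<lambda>i. r - d (Suc i) - e i) (\<lambda>i. e i * d i / A (i - 1)) n"
  proof
    fix i assume i: "i < n"
    have "[:0, 1:] * s i = smult r (s i) + [:- r, 1:] * s i"
      by (simp add: algebra_simps)
    also have "[:- r, 1:] * s i = smult (A i) (p (Suc i)) - smult (e i) (p i)"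
      using darboux i by simp
    also have "smult (A i) (p (Suc i)) = smult (A i) (s (Suc i)) - smult (d (Suc i)) (s i)"
      using A_pos[of i] i by (simp add: s_Suc smult_add_right)
    also have "smult (e i) (p i) = smult (e i) (s i) - smult (e i * d i / A (i - 1)) (s (i - 1))"
      by (cases i) (simp_all add: s_0 p_0 d_0 s_Suc smult_add_right)
    finally show "[:0, 1:] * s i = smult (A i) (s (Suc i)) + smult (r - d (Suc i) - e i) (s i)
        + smult (e i * d i / A (i - 1)) (s (i - 1))"
      by (simp add: smult_diff_left)
  qed (use A_pos e_pos d_pos s_0 d_0 in auto)
  from Suc.IH[OF this] obtain \<alpha> where \<alpha>: "strict_mono_on {..<n} \<alpha>"
      "s n = smult (lead_coeff (s n)) (\<Prod>i<n. [:- \<alpha> i, 1:])"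
      "\<And>m. m \<le> n \<Longrightarrow> (\<Prod>i<m. [:- \<alpha> i, 1:]) \<in> pcone (s ` {..n})"
    by blast
  \<comment> \<open>Positivity from \<open>r\<close> on forces the zeros supplied by the induction
    to lie left of \<open>r\<close>, so appending \<open>r\<close> keeps them increasing.\<close>
  have s_pos: "0 < poly (s i) x" if "i \<le> n" "x \<ge> r" for i x
    using that
  proof (induction i)
    case (Suc i)
    then show ?case
      using r(3)[of "Suc i" x] d_pos[of "Suc i"] A_pos[of i] by (simp add: s_Suc add_pos_pos)
  qed (simp add: s_0)
  have s_cone: "s i \<in> pcone (p ` {..n})" if "i \<le> n" for i
    using that
  proof (induction i)
    case 0
    show ?case by (rule pcone_base) (force simp: s_0 p_0)
  next
    case (Suc i)
    then show ?case
      unfolding s_Suc using d_pos[of "Suc i"] A_pos[of i]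
      by (intro pcone_add pcone_smult) (auto intro: pcone_base)
  qed
  define \<beta> where "\<beta> i = (if i < n then \<alpha> i else r)" for i
  have \<beta>_prod: "(\<Prod>i<m. [:- \<beta> i, 1:]) = (\<Prod>i<m. [:- \<alpha> i, 1:])" if "m \<le> n" for m
    using that by (intro prod.cong) (auto simp: \<beta>_def)
  have less_r: "\<alpha> i < r" if "i < n" for i
  proof (rule ccontr)
    assume "\<not> \<alpha> i < r"
    then have "0 < poly (s n) (\<alpha> i)" using s_pos by simp
    moreover have "poly (s n) (\<alpha> i) = 0"
      using that by (subst \<alpha>(2)) (auto simp: poly_prod prod_zero_iff)
    ultimately show False by simp
  qed
  have mono: "strict_mono_on {..<Suc n} \<beta>"
    using \<alpha>(1) less_r by (auto simp: strict_mono_on_def \<beta>_def less_Suc_eq)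
  have "smult (A n) (p (Suc n)) = [:- r, 1:] * s n"
    using darboux[of n] e_n by simp
  also have "\<dots> = smult (lead_coeff (s n)) (\<Prod>i<Suc n. [:- \<beta> i, 1:])"
    by (subst \<alpha>(2)) (simp add: \<beta>_prod, simp add: \<beta>_def mult.commute)
  finally have pA: "smult (A n) (p (Suc n)) = smult (lead_coeff (s n)) (\<Prod>i<Suc n. [:- \<beta> i, 1:])" .
  have An: "A n > 0" by (simp add: A_pos)
  from pA have "lead_coeff (smult (A n) (p (Suc n))) = lead_coeff (s n)"
    by (simp only: lead_coeff_smult lead_coeff_prod) simp
  then have lc: "lead_coeff (s n) = A n * lead_coeff (p (Suc n))"
    using An by simp
  have main: "p (Suc n) = smult (lead_coeff (p (Suc n))) (\<Prod>i<Suc n. [:- \<beta> i, 1:])"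
  proof -
    have "p (Suc n) = smult (inverse (A n)) (smult (A n) (p (Suc n)))"
      using An by simp
    also have "\<dots> = smult (inverse (A n) * (A n * lead_coeff (p (Suc n)))) (\<Prod>i<Suc n. [:- \<beta> i, 1:])"
      unfolding pA lc by (rule smult_smult)
    also have "inverse (A n) * (A n * lead_coeff (p (Suc n))) = lead_coeff (p (Suc n))"
      using An by (simp add: field_simps)
    finally show ?thesis .
  qed
  have "(\<Prod>i<m. [:- \<beta> i, 1:]) \<in> pcone (p ` {..Suc n})" if "m \<le> Suc n" for m
  proof (cases "m \<le> n")
    case True
    have "s ` {..n} \<subseteq> pcone (p ` {..n})" using s_cone by auto
    then have "(\<Prod>i<m. [:- \<beta> i, 1:]) \<in> pcone (p ` {..n})"
      using \<alpha>(3)[OF True] \<beta>_prod[OF True] by (auto intro: pcone_trans)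
    then show ?thesis by (rule pcone_trans) (auto intro: pcone_base)
  next
    case False
    then have m: "m = Suc n" using that by simp
    have l: "0 < lead_coeff (p (Suc n))" by (rule lead_coeff_pos) simp
    \<comment> \<open>The full product is a positive multiple of \<open>p (Suc n)\<close>, which is
      itself a generator.\<close>
    have "(\<Prod>i<m. [:- \<beta> i, 1:]) = smult (inverse (lead_coeff (p (Suc n)))) (p (Suc n))"
    proof -
      have "f = smult c g \<Longrightarrow> 0 < c \<Longrightarrow> g = smult (inverse c) f" for f g :: "real poly" and c
        by simp
      from this[OF main l] show ?thesis unfolding m .
    qed
    also have "\<dots> \<in> pcone (p ` {..Suc n})"
      using l by (intro pcone_smult pcone_base) auto
    finally show ?thesis .
  qed
  with mono main show ?case by blast
qed

subsection \<open>Gegenbauer polynomials\<close>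

text \<open>The backward coefficient in the three-term recurrence of the Gegenbauer polynomials
  normalized at 1. For \<open>n = 2\<close> and \<open>i = 0\<close> the quotient is 0 / 0, whose
  value 0 is the one required.\<close>

definition geg_al :: "nat \<Rightarrow> nat \<Rightarrow> real" where
  "geg_al n i = real i / (2 * real i + real n - 2)"

text \<open>A recursion to compute with, in place of the definite description
  \<open>gegenbauer\<close>; \<open>gegenbauer_eq_geg\<close> identifies the two for
  \<open>2 \<le> n\<close>.\<close>

fun geg :: "nat \<Rightarrow> nat \<Rightarrow> real poly" where
  "geg n 0 = 1"
| "geg n (Suc i) = smult (1 / (1 - geg_al n i))
     ([:0, 1:] * geg n i - smult (geg_al n i) (if i = 0 then 0 else geg n (i - 1)))"

text \<open>
  \<open>geg_dim n i\<close> is the inverse of the squared norm of \<open>geg n i\<close>, the dimension of the space of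
  spherical harmonics of degree \<open>i\<close>. The polynomial \<open>even_ker n j\<close> sums \<open>geg_dim n i * geg n i\<close> over
  the \<open>i \<le> j\<close> of the same parity as \<open>j\<close>; it is the reproducing kernel of the point 1 for the
  weight \<open>1 + t\<close>, and proportional to the Gegenbauer polynomial of degree \<open>j\<close> in dimension \<open>n + 2\<close>.
\<close>

fun geg_dim :: "nat \<Rightarrow> nat \<Rightarrow> real" where
  "geg_dim n 0 = 1"
| "geg_dim n (Suc i) = geg_dim n i * (1 - geg_al n i) / geg_al n (Suc i)"

fun even_ker :: "nat \<Rightarrow> nat \<Rightarrow> real poly" where
  "even_ker n 0 = 1"
| "even_ker n (Suc 0) = smult (geg_dim n 1) (geg n 1)"
| "even_ker n (Suc (Suc j)) = even_ker n j + smult (geg_dim n (Suc (Suc j))) (geg n (Suc (Suc j)))"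

lemma poly_eqI_real:
  fixes p q :: "real poly"
  assumes "\<And>x. poly p x = poly q x"
  shows "p = q"
  using assms poly_eq_poly_eq_iff by blast

lemma span_by_degree:
  fixes P :: "nat \<Rightarrow> real poly"
  assumes "\<And>i. degree (P i) = i" and "\<And>i. P i \<noteq> 0" and "degree p \<le> m"
  shows "\<exists>c. p = (\<Sum>i\<le>m. smult (c i) (P i))"
  using assms(3)
proof (induction m arbitrary: p)
  case 0
  obtain a where "p = [:a:]" using 0 degree_eq_zeroE by blast
  moreover obtain b where b: "P 0 = [:b:]" using assms(1)[of 0] degree_eq_zeroE by blast
  moreover have "b \<noteq> 0" using assms(2)[of 0] b by auto
  ultimately show ?case by (intro exI[of _ "\<lambda>_. a / b"]) simp
next
  case (Suc m)
  define a where "a = coeff p (Suc m) / lead_coeff (P (Suc m))"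
  have l: "lead_coeff (P (Suc m)) \<noteq> 0" using assms(2) by simp
  have "degree (p - smult a (P (Suc m))) \<le> m"
  proof (rule degree_le, intro allI impI)
    fix k assume "m < k"
    then consider "k = Suc m" | "k > Suc m" by linarith
    then show "coeff (p - smult a (P (Suc m))) k = 0"
    proof cases
      case 1
      then show ?thesis using l by (simp add: a_def assms(1))
    next
      case 2
      then have "coeff p k = 0" "coeff (P (Suc m)) k = 0"
        using Suc.prems assms(1)[of "Suc m"] by (simp_all add: coeff_eq_0)
      then show ?thesis by simp
    qed
  qed
  from Suc.IH[OF this] obtain c where c: "p - smult a (P (Suc m)) = (\<Sum>i\<le>m. smult (c i) (P i))"
    by blast
  have "(\<Sum>i\<le>m. smult ((c(Suc m := a)) i) (P i)) = (\<Sum>i\<le>m. smult (c i) (P i))"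
    by (rule sum.cong) auto
  then have "p = (\<Sum>i\<le>Suc m. smult ((c(Suc m := a)) i) (P i))"
    using c by (simp add: algebra_simps)
  then show ?case by blast
qed

declare geg.simps(2) [simp del]

text \<open>
  \<open>L\<close> is integration against the Gegenbauer measure, of which only the following is needed;
  \<open>L_ibp\<close> determines all moments.
\<close>

locale gegenbauer_functional =
  fixes n :: nat and L :: "real poly \<Rightarrow> real"
  assumes n2: "2 \<le> n"
    and L_add: "L (p + q) = L p + L q"
    and L_smult: "L (smult c p) = c * L p"
    and L_1: "L 1 = 1"
    and L_nonneg: "(\<And>t. -1 \<le> t \<Longrightarrow> t \<le> 1 \<Longrightarrow> 0 \<le> poly p t) \<Longrightarrow> 0 \<le> L p"
    and L_ibp: "L ([:1, 0, -1:] * pderiv p) = (real n - 1) * L ([:0, 1:] * p)"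
begin

abbreviation "al \<equiv> geg_al n"
abbreviation "P \<equiv> geg n"
abbreviation "r \<equiv> geg_dim n"
abbreviation "E \<equiv> even_ker n"
abbreviation "X \<equiv> [:0, 1:] :: real poly"

lemma L_0: "L 0 = 0"
  using L_smult[of 0 0] by simp

lemma L_minus: "L (- p) = - L p"
  using L_smult[of "-1" p] by simp

lemma L_diff: "L (p - q) = L p - L q"
  using L_add[of p "- q"] by (simp add: L_minus)

lemma L_sum: "L (\<Sum>i\<in>I. f i) = (\<Sum>i\<in>I. L (f i))"
  by (induction I rule: infinite_finite_induct) (auto simp: L_0 L_add)

lemmas L_linear = L_0 L_add L_diff L_smult L_sum L_minus

lemma al_0 [simp]: "al 0 = 0"
  by (simp add: geg_al_def)

lemma al_pos: "0 < i \<Longrightarrow> 0 < al i"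
  using n2 by (simp add: geg_al_def)

lemma al_less: "al i < 1"
  using n2 by (cases "i = 0") (simp_all add: geg_al_def field_simps)

lemma dim_pos: "0 < r i"
  by (induction i) (use al_pos al_less in \<open>auto simp: field_simps\<close>)

lemma rec_P: "X * P i = smult (1 - al i) (P (Suc i)) + smult (al i) (P (i - 1))"
  using al_less[of i] by (cases "i = 0") (simp_all add: geg.simps(2) smult_diff_right)

lemma P_Suc_0 [simp]: "P (Suc 0) = X"
  by (simp add: geg.simps(2))

lemma P_1: "poly (P i) 1 = 1"
proof (induction i rule: less_induct)
  case (less i)
  show ?case
  proof (cases i)
    case (Suc j)
    then show ?thesis
      using less.IH[of j] less.IH[of "j - 1"] al_less[of j] by (cases "j = 0") (auto simp: field_simps geg.simps(2))
  qed simp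
qed

lemma jacobi_P: "jacobi P (\<lambda>i. 1 - al i) (\<lambda>_. 0) al m"
  by standard (use al_pos al_less rec_P in auto)

lemma degree_P: "degree (P i) = i"
  using jacobi.degree_lead_coeff[OF jacobi_P, of i i] by simp

lemma P_nonzero: "P i \<noteq> 0"
  using P_1[of i] by auto

text \<open>Lowering and raising relations. The first follows by differentiating the recurrence and
  inserting the first relation for the previous degree and the second for the one before; the
  recurrence then turns the first into the second. Hence one induction carries both.\<close>

lemma deriv_P:
  "[:1, 0, -1:] * pderiv (P i) = smult (real i) (P (i - 1) - X * P i)"
  "[:1, 0, -1:] * pderiv (P i) = smult (real i + real n - 2) (X * P i - P (Suc i))"
proof -
  have *: "[:1, 0, -1:] * pderiv (P i) = smult (real i) (P (i - 1) - X * P i) \<and>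
    [:1, 0, -1:] * pderiv (P i) = smult (real i + real n - 2) (X * P i - P (Suc i))" for i
  proof (induction i rule: less_induct)
    case (less i)
    have a: "[:1, 0, -1:] * pderiv (P i) = smult (real i) (P (i - 1) - X * P i)"
    proof (cases "i \<le> 1")
      case True
      then consider "i = 0" | "i = Suc 0" by linarith
      then show ?thesis by cases (auto simp: pderiv_pCons one_pCons)
    next
      case False
      then have "i = Suc (Suc (i - 2))" by simp
      then obtain j where j: "i = Suc (Suc j)" ..
      define c where "c = real n - 2"
      have c0: "c \<ge> 0" using n2 by (simp add: c_def)
      define k where "k = real j + 1"
      have k: "k > 0" by (simp add: k_def)
      have alk: "al (Suc j) = k / (2 * k + c)" by (simp add: geg_al_def k_def c_def)
      have nz: "2 * k + c > 0" "k + c > 0" using k c0 by auto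
      have rec: "smult (k + c) (P i) = smult (2 * k + c) (X * P (Suc j)) - smult k (P j)"
      proof -
        have "smult (2 * k + c) (X * P (Suc j)) =
            smult (2 * k + c) (smult (1 - al (Suc j)) (P i) + smult (al (Suc j)) (P j))"
          using rec_P[of "Suc j"] by (simp add: j)
        moreover have "(2 * k + c) * (1 - al (Suc j)) = k + c" "(2 * k + c) * al (Suc j) = k"
          using nz by (simp_all add: alk field_simps)
        ultimately show ?thesis
          by (simp add: smult_add_right del: mult_pCons_left)
      qed
      have d1: "[:1, 0, -1:] * pderiv (P (Suc j)) = smult k (P j - X * P (Suc j))"
        using less.IH[of "Suc j"] j by (simp add: k_def add_ac)
      have d0: "[:1, 0, -1:] * pderiv (P j) = smult (k - 1 + c) (X * P j - P (Suc j))"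
      proof -
        have "k - 1 + c = real j + real n - 2" by (simp add: k_def c_def)
        moreover have "j < i" using j by simp
        ultimately show ?thesis using less.IH[of j] by metis
      qed
      have "smult (k + c) ([:1, 0, -1:] * pderiv (P i)) = [:1, 0, -1:] * pderiv (smult (k + c) (P i))"
        by (simp add: pderiv_smult)
      also have "\<dots> = smult (2 * k + c) ([:1, 0, -1:] * P (Suc j)
          + X * ([:1, 0, -1:] * pderiv (P (Suc j)))) - smult k ([:1, 0, -1:] * pderiv (P j))"
        unfolding rec by (simp add: pderiv_smult pderiv_diff pderiv_mult pderiv_pCons algebra_simps
          smult_add_right smult_diff_right)
      also have "\<dots> = smult (k + c) (smult (k + 1) (P (Suc j) - X * P i))"
      proof -
        have "(2 * k + c) * ((1 - x * x) * u + x * (k * (v - x * u))) - k * ((k - 1 + c) * (x * v - u))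
            = (k + c) * ((k + 1) * (u - x * t))"
          if "(k + c) * t = (2 * k + c) * (x * u) - k * v" for x t u v :: real
          using that by algebra
        from this[OF arg_cong[OF rec, of "\<lambda>q. poly q x" for x, unfolded poly_smult poly_diff poly_mult]]
        show ?thesis
          unfolding d1 d0 by (intro poly_eqI_real) (simp add: algebra_simps)
      qed
      finally have "smult (k + c) ([:1, 0, -1:] * pderiv (P i)) =
          smult (k + c) (smult (k + 1) (P (Suc j) - X * P i))" .
      moreover have "smult a f = smult a g \<Longrightarrow> 0 < a \<Longrightarrow> f = g" for a :: real and f g
        by (drule arg_cong[where f = "smult (inverse a)"]) (simp only: smult_smult, simp)
      moreover have "real i = k + 1" by (simp add: j k_def)
      ultimately show ?thesis
        using nz(2) by (metis j diff_Suc_1)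
    qed
    moreover have "smult (real i) (P (i - 1) - X * P i) = smult (real i + real n - 2) (X * P i - P (Suc i))"
    proof (cases "i = 0")
      case False
      define D where "D = 2 * real i + real n - 2"
      have D: "D > 0" using False n2 by (simp add: D_def)
      have "smult D (X * P i) = smult D (smult (1 - al i) (P (Suc i)) + smult (al i) (P (i - 1)))"
        by (simp only: rec_P)
      also have "\<dots> = smult (real i + real n - 2) (P (Suc i)) + smult (real i) (P (i - 1))"
      proof -
        have "D * (1 - al i) = real i + real n - 2" "D * al i = real i"
          using D by (simp_all add: geg_al_def D_def field_simps)
        then show ?thesis by (simp add: smult_add_right)
      qed
      finally have "smult D (X * P i) = smult (real i + real n - 2) (P (Suc i)) + smult (real i) (P (i - 1))" .
      moreover have "smult D (X * P i) = smult (real i + real n - 2) (X * P i) + smult (real i) (X * P i)"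
      proof -
        have "D = (real i + real n - 2) + real i" by (simp add: D_def)
        then show ?thesis by (simp only: smult_add_left)
      qed
      ultimately show ?thesis
        by (simp add: smult_diff_right algebra_simps)
    qed simp
    ultimately show ?case by simp
  qed
  then show "[:1, 0, -1:] * pderiv (P i) = smult (real i) (P (i - 1) - X * P i)"
    "[:1, 0, -1:] * pderiv (P i) = smult (real i + real n - 2) (X * P i - P (Suc i))"
    by blast+
qed

text \<open>Integration by parts, with the derivative of \<open>P j\<close> written in both ways,
  relates \<open>L (X * P j)\<close> to \<open>L (P (j - 1))\<close> and to
  \<open>L (P (Suc j))\<close>. Eliminating it gives a recursion in steps of two.\<close>

lemma L_P: "0 < i \<Longrightarrow> L (P i) = 0"
proof (induction i rule: less_induct)
  case (less i)
  have LX: "L (X * P j) = real j / (real j + real n - 1) * L (P (j - 1))" for j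
  proof -
    have "real j * (L (P (j - 1)) - L (X * P j)) = (real n - 1) * L (X * P j)"
      using L_ibp[of "P j"] unfolding deriv_P(1) by (simp only: L_linear)
    then show ?thesis using n2 by (simp add: field_simps)
  qed
  show ?case
  proof (cases "i = 1")
    case True
    then show ?thesis using LX[of 0] by simp
  next
    case False
    then obtain j where j: "i = Suc j" "0 < j" using less.prems by (cases i) auto
    have "(real j + real n - 2) * (L (X * P j) - L (P i)) = (real n - 1) * L (X * P j)"
      using L_ibp[of "P j"] unfolding deriv_P(2) j(1) by (simp only: L_linear)
    then have "(real j + real n - 2) * L (P i) = (real j - 1) * L (X * P j)"
      by (simp add: algebra_simps)
    \<comment> \<open>For \<open>j = 1\<close> the induction would reach \<open>L (P 0) = 1\<close>,
      but there the factor \<open>real j - 1\<close> vanishes.\<close>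
    also have "\<dots> = 0"
      using less.IH[of "j - 1"] j LX[of j] by (cases "j = 1") auto
    finally show ?thesis using j n2 by simp
  qed
qed

text \<open>The recurrence moves a factor \<open>X\<close> from \<open>P i\<close> over to
  \<open>P j\<close>, which lowers the smaller index while the indices stay apart; the base case is
  \<open>L_P\<close>.\<close>

lemma orth: "i < j \<Longrightarrow> L (P i * P j) = 0"
proof (induction i arbitrary: j rule: less_induct)
  case (less i)
  show ?case
  proof (cases i)
    case 0
    then show ?thesis using less L_P by simp
  next
    case (Suc k)
    have "P i * P j = smult (1 / (1 - al k)) (P k * (X * P j) - smult (al k) (P (k - 1) * P j))"
      using al_less[of k] by (cases "k = 0") (simp_all add: Suc geg.simps(2) algebra_simps smult_diff_right)
    also have "P k * (X * P j) = smult (1 - al j) (P k * P (Suc j)) + smult (al j) (P k * P (j - 1))"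
      unfolding rec_P by (simp add: algebra_simps)
    finally have eq: "L (P i * P j) = 1 / (1 - al k) * ((1 - al j) * L (P k * P (Suc j))
        + al j * L (P k * P (j - 1)) - al k * L (P (k - 1) * P j))"
      by (simp only: L_linear)
    have "L (P k * P (Suc j)) = 0" "L (P k * P (j - 1)) = 0" "L (P (k - 1) * P j) = 0"
      using less Suc by auto
    then show ?thesis using eq by simp
  qed
qed

lemma orth': "i \<noteq> j \<Longrightarrow> L (P i * P j) = 0"
  using orth[of i j] orth[of j i] by (cases "i < j") (auto simp: mult.commute)

text \<open>Expanding \<open>X\<close> in either factor of \<open>L (X * P i * P (Suc i))\<close>
  gives the ratio of consecutive squared norms, which is the inverse of the ratio defining
  \<open>geg_dim\<close>.\<close>

lemma norm_P: "r i * L (P i * P i) = 1"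
proof (induction i)
  case (Suc i)
  have "L (X * P i * P (Suc i)) = (1 - al i) * L (P (Suc i) * P (Suc i)) + al i * L (P (i - 1) * P (Suc i))"
    unfolding rec_P by (simp only: distrib_right mult_smult_left L_linear)
  moreover have "X * P i * P (Suc i) = P i * (X * P (Suc i))"
    by (simp add: algebra_simps)
  moreover have "L (P i * (X * P (Suc i))) = (1 - al (Suc i)) * L (P i * P (Suc (Suc i))) + al (Suc i) * L (P i * P i)"
    unfolding rec_P by (simp only: distrib_left mult_smult_right L_linear) simp
  ultimately have "(1 - al i) * L (P (Suc i) * P (Suc i)) = al (Suc i) * L (P i * P i)"
    using orth[of "i - 1" "Suc i"] orth[of i "Suc (Suc i)"] by simp
  moreover have "r (Suc i) * L (P (Suc i) * P (Suc i)) =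
      r i / al (Suc i) * ((1 - al i) * L (P (Suc i) * P (Suc i)))"
    by simp
  ultimately have "r (Suc i) * L (P (Suc i) * P (Suc i)) = r i * L (P i * P i)"
    using al_pos[of "Suc i"] by simp
  then show ?case using Suc by (rule trans)
qed (simp add: L_1)

text \<open>\<open>L_nonneg\<close> alone is not strict. Strictness comes from Parseval's identity
  for the orthogonal expansion of \<open>u\<close>.\<close>

lemma L_square_pos:
  assumes "u \<noteq> 0"
  shows "0 < L (u * u)"
proof -
  define m where "m = degree u"
  obtain c where c: "u = (\<Sum>i\<le>m. smult (c i) (P i))"
    using span_by_degree[of P u m] degree_P P_nonzero by (auto simp: m_def)
  have Lu: "L (P j * u) = c j / r j" if "j \<le> m" for j
  proof -
    have "L (P j * u) = (\<Sum>i\<le>m. c i * L (P j * P i))"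
      by (subst c) (simp only: sum_distrib_left mult_smult_right L_linear)
    also have "\<dots> = (\<Sum>i\<le>m. if i = j then c j / r j else 0)"
      using norm_P[of j] dim_pos[of j] by (intro sum.cong) (auto simp: orth' field_simps)
    finally show ?thesis using that by simp
  qed
  have "L (u * u) = (\<Sum>i\<le>m. c i * L (P i * u))"
    by (subst (1) c) (simp only: sum_distrib_right mult_smult_left L_linear)
  also have "\<dots> = (\<Sum>i\<le>m. (c i)\<^sup>2 / r i)"
    by (intro sum.cong) (auto simp: Lu power2_eq_square)
  finally have eq: "L (u * u) = (\<Sum>i\<le>m. (c i)\<^sup>2 / r i)" .
  obtain j where "j \<le> m" "c j \<noteq> 0"
    using assms c by (metis (no_types, lifting) atMost_iff smult_0_left sum.neutral)
  then show ?thesis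
    unfolding eq using dim_pos by (intro sum_pos2[of _ j]) (auto simp: less_imp_le)
qed

end

text \<open>Only the recurrence at \<open>i = k - 1\<close> sees the top polynomial, and there the
  change is absorbed by the diagonal coefficient. This brings \<open>F k + c F (k-1)\<close> within
  reach of \<open>jacobi_partial_products\<close>.\<close>

lemma jacobi_change_top:
  assumes "jacobi p A B C k" "0 < k"
  shows "jacobi (p(k := p k + smult c (p (k - 1)))) A (B(k - 1 := B (k - 1) - A (k - 1) * c)) C k"
proof -
  interpret jacobi p A B C k by fact
  show ?thesis
  proof
    fix i assume i: "i < k"
    show "[:0, 1:] * (p(k := p k + smult c (p (k - 1)))) i =
        smult (A i) ((p(k := p k + smult c (p (k - 1)))) (Suc i)) +
        smult ((B(k - 1 := B (k - 1) - A (k - 1) * c)) i) ((p(k := p k + smult c (p (k - 1)))) i) +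
        smult (C i) ((p(k := p k + smult c (p (k - 1)))) (i - 1))"
    proof (cases "i = k - 1")
      case True
      then show ?thesis
        using rec[OF i] i by (simp add: smult_add_right smult_diff_left del: mult_pCons_left)
    next
      case False
      then have "Suc i \<noteq> k" "i \<noteq> k" "i - 1 \<noteq> k" using i by auto
      then show ?thesis using rec[OF i] False by (simp del: mult_pCons_left)
    qed
  qed (use p_0 C_0 A_pos C_pos \<open>0 < k\<close> in auto)
qed

text \<open>
  Askey's linearization criterion. The induction carries along the differences
  \<open>A\<^sub>i p\<^sub>i\<^sub>+\<^sub>1 p\<^sub>j - A\<^sub>j p\<^sub>i p\<^sub>j\<^sub>+\<^sub>1\<close>.
\<close>

lemma askey_linearization:
  fixes p :: "nat \<Rightarrow> real poly" and A C :: "nat \<Rightarrow> real"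
  assumes p_0: "p 0 = 1"
    and A_pos: "\<And>i. 0 < A i" and C_nonneg: "\<And>i. 0 \<le> C i" and C_0: "C 0 = 0"
    and rec: "\<And>i. [:0, 1:] * p i = smult (A i) (p (Suc i)) + smult (C i) (p (i - 1))"
    and mono: "\<And>i j. 0 < i \<Longrightarrow> i \<le> j \<Longrightarrow> A (i - 1) * C i \<le> A (j - 1) * C j"
  shows "p i * p j \<in> pcone (range p)"
proof -
  define D where "D i j = smult (A i) (p (Suc i) * p j) - smult (A j) (p i * p (Suc j))" for i j
  \<comment> \<open>Both sides arise by expanding the product of \<open>[:0, 1:]\<close>,
    \<open>p i\<close> and \<open>p j\<close> through the recurrence of either factor.\<close>
  have D: "D i j = smult (C j) (p i * p (j - 1)) - smult (C i) (p (i - 1) * p j)" for i j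
  proof -
    have "([:0, 1:] * p i) * p j = p i * ([:0, 1:] * p j)" by (simp add: algebra_simps)
    then have "smult (A i) (p (Suc i) * p j) + smult (C i) (p (i - 1) * p j) =
      smult (A j) (p i * p (Suc j)) + smult (C j) (p i * p (j - 1))"
      unfolding rec by (simp add: algebra_simps)
    then show ?thesis by (simp add: D_def algebra_simps)
  qed
  have *: "\<forall>j\<ge>i. p i * p j \<in> pcone (range p) \<and> D i j \<in> pcone (range p)" for i
  proof (induction i)
    case 0
    show ?case
    proof (intro allI impI conjI)
      fix j :: nat
      show "p 0 * p j \<in> pcone (range p)" by (auto simp: p_0 intro: pcone_base)
      show "D 0 j \<in> pcone (range p)"
        unfolding D using C_nonneg[of j] by (simp add: p_0 C_0 pcone_smult pcone_base)
    qed
  next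
    case (Suc i)
    have prod: "p (Suc i) * p j \<in> pcone (range p)" if "Suc i \<le> j" for j
    proof -
      have "p (Suc i) * p j = smult (inverse (A i)) (smult (A j) (p i * p (Suc j)) + D i j)"
        using A_pos[of i] by (simp add: D_def)
      also have "\<dots> \<in> pcone (range p)"
        using Suc that A_pos[of i] A_pos[of j] by (intro pcone_smult pcone_add) auto
      finally show ?thesis .
    qed
    show ?case
    proof (intro allI impI conjI)
      fix j assume j: "Suc i \<le> j"
      then obtain l where l: "j = Suc l" by (cases j) auto
      show "p (Suc i) * p j \<in> pcone (range p)" by (rule prod[OF j])
      show "D (Suc i) j \<in> pcone (range p)"
      proof (cases "j = Suc i")
        case True
        then show ?thesis by (simp add: D_def mult.commute pcone.zero)
      next
        case False
        have Al: "A l > 0" by (rule A_pos)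
        \<comment> \<open>The negative term of \<open>D (Suc i) j\<close> is traded for
          \<open>D i l\<close>; the monotonicity hypothesis makes the remaining coefficient
          nonnegative.\<close>
        have "smult (A l) (D (Suc i) j) = smult (C (Suc i)) (D i l) +
            smult (A l * C j - A i * C (Suc i)) (p (Suc i) * p l)"
          unfolding D[of "Suc i"] unfolding D_def l
          by (simp add: smult_diff_right smult_diff_left mult.commute)
        also have "\<dots> \<in> pcone (range p)"
          using Suc j l False prod[of l] C_nonneg[of "Suc i"] mono[of "Suc i" j]
          by (intro pcone_smult pcone_add) auto
        finally have "smult (inverse (A l)) (smult (A l) (D (Suc i) j)) \<in> pcone (range p)"
          using Al by (intro pcone_smult[where p = "smult (A l) (D (Suc i) j)"]) auto
        then show ?thesis using Al by simp
      qed
    qed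
  qed
  show ?thesis
    using *[of i] *[of j] by (cases "i \<le> j") (auto simp: mult.commute)
qed

section \<open>Reproducing kernels of the point 1, their recurrences and their cones\<close>

context gegenbauer_functional
begin

lemma dim_rec: "r (Suc i) * al (Suc i) = r i * (1 - al i)"
  using al_pos[of "Suc i"] by simp

lemma dim_P_eq: "smult (r i) (P i) = E i - (if i < 2 then 0 else E (i - 2))"
proof -
  consider "i = 0" | "i = Suc 0" | j where "i = Suc (Suc j)" by (metis not0_implies_Suc)
  then show ?thesis by cases simp_all
qed

text \<open>Multiplication by \<open>r i\<close> transposes the recurrence of \<open>P\<close>. In a
  sum over one parity class the two contributions to each lower term are \<open>al m\<close> and
  \<open>1 - al m\<close>, so they add up to 1 and only the top term keeps a coefficient.\<close>

lemma rec_E: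
  "X * E j = smult (al (Suc j)) (E (Suc j)) + smult (if j = 0 then 0 else 1 - al (Suc j)) (E (j - 1))"
proof -
  have XP: "X * smult (r i) (P i) =
      smult (al (Suc i)) (smult (r (Suc i)) (P (Suc i))) + smult (r i * al i) (P (i - 1))" for i
    using dim_rec[of i] unfolding mult_smult_right rec_P
    by (simp add: smult_add_right mult.commute del: geg_dim.simps)
  have XP': "X * smult (r (Suc i)) (P (Suc i)) =
      smult (al (Suc (Suc i))) (smult (r (Suc (Suc i))) (P (Suc (Suc i)))) +
      smult (1 - al i) (smult (r i) (P i))" for i
    using XP[of "Suc i"] unfolding dim_rec[of i] by (simp add: mult.commute del: geg_dim.simps mult_pCons_left)
  show ?thesis
  proof (induction j rule: induct_nat_012[case_names 0 1 step])
    case 0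
    then show ?case using XP[of 0] by simp
  next
    case 1
    show ?case using XP'[of 0]
      by (simp add: smult_add_right smult_diff_left del: geg_dim.simps(2) mult_pCons_left)
  next
    case (step j)
    have "X * E (Suc (Suc j)) = X * E j + X * smult (r (Suc (Suc j))) (P (Suc (Suc j)))"
      by (simp add: distrib_left del: geg_dim.simps(2) mult_pCons_left)
    also have "X * smult (r (Suc (Suc j))) (P (Suc (Suc j))) =
        smult (al (Suc (Suc (Suc j)))) (E (Suc (Suc (Suc j))) - E (Suc j)) +
        smult (1 - al (Suc j)) (E (Suc j) - (if j = 0 then 0 else E (j - 1)))"
      unfolding XP' unfolding dim_P_eq by (simp add: numeral_2_eq_2 del: even_ker.simps)
    finally show ?case
      unfolding step
      by (simp add: smult_diff_right smult_diff_left del: even_ker.simps geg_dim.simps)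
  qed
qed

text \<open>The source of the binomials in the Delsarte--Goethals--Seidel bound: they satisfy
  \<open>rec_E\<close> evaluated at 1, by absorption.\<close>

lemma E_1: "poly (E j) 1 = real ((n + j - 1) choose (n - 1))"
proof (induction j rule: less_induct)
  case (less j)
  show ?case
  proof (cases j)
    case 0
    then show ?thesis by simp
  next
    case (Suc i)
    define T where "T j = real ((n + j - 1) choose (n - 1))" for j
    have T_Suc: "T (Suc j) * (real j + 1) = T j * (real n + real j)" for j
    proof -
      obtain m where m: "n = Suc m" using n2 by (cases n) auto
      show ?thesis
        using arg_cong[OF binomial_absorb_comp[of "Suc (m + j)" m], of real]
        unfolding T_def m by (simp add: algebra_simps)
    qed
    have a: "al (Suc i) = (real i + 1) / (2 * real i + real n)"
      by (simp add: geg_al_def)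
    have nz: "2 * real i + real n > 0" using n2 by simp
    have "poly (E i) 1 = al (Suc i) * poly (E (Suc i)) 1 + (if i = 0 then 0 else 1 - al (Suc i)) * poly (E (i - 1)) 1"
      using arg_cong[OF rec_E[of i], of "\<lambda>q. poly q 1"] by simp
    moreover have "poly (E i) 1 = T i" "i > 0 \<Longrightarrow> poly (E (i - 1)) 1 = T (i - 1)"
      using less Suc by (auto simp: T_def)
    moreover have "T i = al (Suc i) * T (Suc i) + (if i = 0 then 0 else 1 - al (Suc i)) * T (i - 1)"
    proof (cases i)
      case 0
      then show ?thesis using T_Suc[of 0] n2 by (simp add: geg_al_def field_simps T_def)
    next
      case (Suc l)
      have "T (Suc i) * (real i + 1) = T i * (real n + real i)" "T i * real i = T l * (real n + real i - 1)"
        using T_Suc[of i] T_Suc[of l] Suc by (simp_all add: algebra_simps)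
      moreover have "real n + real i - 1 > 0" using n2 by simp
      moreover have "real i + 1 > 0" by simp
      ultimately have "T (Suc i) = T i * (real n + real i) / (real i + 1)"
          "T l = T i * real i / (real n + real i - 1)"
        by (metis nonzero_eq_divide_eq less_irrefl)+
      moreover have "1 - al (Suc i) = (real n + real i - 1) / (2 * real i + real n)"
        using nz by (simp add: a field_simps)
      ultimately have "al (Suc i) * T (Suc i) = T i * (real n + real i) / (2 * real i + real n)"
          "(1 - al (Suc i)) * T l = T i * real i / (2 * real i + real n)"
        using \<open>real n + real i - 1 > 0\<close> \<open>real i + 1 > 0\<close> by (simp_all add: a)
      then have "al (Suc i) * T (Suc i) + (1 - al (Suc i)) * T l =
          T i * (real n + real i) / (2 * real i + real n) + T i * real i / (2 * real i + real n)"
        by simp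
      also have "\<dots> = T i * (2 * real i + real n) / (2 * real i + real n)"
        by (simp add: add_divide_distrib[symmetric] algebra_simps)
      also have "\<dots> = T i" using nz by simp
      finally have "al (Suc i) * T (Suc i) + (1 - al (Suc i)) * T l = T i" .
      then show ?thesis using Suc by simp
    qed
    moreover have "(if i = 0 then 0 else 1 - al (Suc i)) * poly (E (i - 1)) 1 =
        (if i = 0 then 0 else 1 - al (Suc i)) * T (i - 1)"
      using calculation(3) by (cases "i = 0") (simp_all del: even_ker.simps)
    ultimately have "al (Suc i) * poly (E (Suc i)) 1 = al (Suc i) * T (Suc i)"
      by linarith
    moreover have "al (Suc i) \<noteq> 0" using al_pos[of "Suc i"] by simp
    ultimately have "poly (E (Suc i)) 1 = T (Suc i)"
      using mult_left_cancel by blast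
    then show ?thesis unfolding Suc T_def .
  qed
qed

text \<open>The two parity classes together give the sum of \<open>geg_dim n i * geg n i\<close>
  over all \<open>i \<le> j\<close>, the reproducing kernel of the point 1 for the weight 1.\<close>

definition K :: "nat \<Rightarrow> real poly" where
  "K j = E j + (if j = 0 then 0 else E (j - 1))"

lemma rec_K:
  "X * K j = smult (al (Suc j)) (K (Suc j)) + smult (al j - al (Suc j)) (K j)
    + smult (if j = 0 then 0 else 1 - al j) (K (j - 1))"
proof -
  consider "j = 0" | "j = Suc 0" | l where "j = Suc (Suc l)" by (metis not0_implies_Suc)
  then show ?thesis
  proof cases
    case 1
    then show ?thesis using rec_E[of 0]
      by (simp add: K_def smult_add_right smult_diff_left del: mult_pCons_left even_ker.simps(2,3))
  next
    case 2
    then show ?thesis using rec_E[of 0] rec_E[of "Suc 0"]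
      by (simp add: K_def smult_add_right smult_diff_left distrib_left del: mult_pCons_left even_ker.simps(2,3))
  next
    case 3
    then show ?thesis using rec_E[of j] rec_E[of "Suc l"]
      by (simp add: K_def smult_add_right smult_diff_left distrib_left del: mult_pCons_left even_ker.simps(2,3))
  qed
qed

lemma jacobi_E: "jacobi E (\<lambda>i. al (Suc i)) (\<lambda>_. 0) (\<lambda>j. if j = 0 then 0 else 1 - al (Suc j)) m"
  by standard (use al_pos al_less rec_E in \<open>auto simp del: mult_pCons_left\<close>)

lemma jacobi_K:
  "jacobi K (\<lambda>i. al (Suc i)) (\<lambda>j. al j - al (Suc j)) (\<lambda>j. if j = 0 then 0 else 1 - al j) m"
  by standard (use al_pos al_less rec_K in \<open>auto simp: K_def simp del: mult_pCons_left\<close>)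

lemma degree_E: "degree (E j) = j"
  using jacobi.degree_lead_coeff[OF jacobi_E, of j j] by simp

lemma degree_K: "degree (K j) = j"
  using jacobi.degree_lead_coeff[OF jacobi_K, of j j] by simp

lemma L_E_P: "L (E j * P i) = (if i \<le> j \<and> even (i + j) then 1 else 0)"
proof -
  have rP: "L (smult (r j) (P j) * P i) = (if i = j then 1 else 0)" for j
    using norm_P[of j] orth'[of j i] by (simp add: L_linear del: geg_dim.simps)
  show ?thesis
  proof (induction j rule: induct_nat_012[case_names 0 1 step])
    case 0
    then show ?case using rP[of 0] by simp
  next
    case 1
    show ?case unfolding even_ker.simps One_nat_def rP by (cases i) (auto simp: le_Suc_eq)
  next
    case (step j)
    have "L (E (Suc (Suc j)) * P i) = L (E j * P i) + L (smult (r (Suc (Suc j))) (P (Suc (Suc j))) * P i)"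
      by (simp add: distrib_right L_linear del: geg_dim.simps)
    then show ?case using step rP[of "Suc (Suc j)"] by (auto simp: le_Suc_eq)
  qed
qed

lemma reproducing_span:
  assumes "\<And>i. i \<le> j \<Longrightarrow> L (F * P i) = 1" and "degree v \<le> j"
  shows "L (F * v) = poly v 1"
proof -
  obtain c where c: "v = (\<Sum>i\<le>j. smult (c i) (P i))"
    using span_by_degree[OF degree_P P_nonzero assms(2)] by blast
  have "L (F * v) = (\<Sum>i\<le>j. c i * L (F * P i))"
    by (simp only: c sum_distrib_left mult_smult_right L_linear)
  also have "\<dots> = poly v 1"
    by (simp add: c poly_sum P_1 assms)
  finally show ?thesis .
qed

text \<open>\<open>E j\<close> pairs to 1 with each \<open>P i\<close> of its own parity and to 0
  with the others, for \<open>i \<le> j\<close>. The factor \<open>1 + X\<close> brings in the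
  neighbours of \<open>P i\<close> with total weight 1, so either \<open>P i\<close> or its
  neighbours contribute 1.\<close>

lemma E_reproducing: "degree v \<le> j \<Longrightarrow> L ([:1, 1:] * E j * v) = poly v 1"
proof (rule reproducing_span)
  fix i assume i: "i \<le> j"
  have "[:1, 1:] * E j * P i = E j * P i + E j * (X * P i)"
    by (simp add: algebra_simps)
  then have "L ([:1, 1:] * E j * P i) =
      L (E j * P i) + (1 - al i) * L (E j * P (Suc i)) + al i * L (E j * P (i - 1))"
    unfolding rec_P by (simp only: distrib_left mult_smult_right L_linear)
  also have "\<dots> = 1"
  proof (cases "even (i + j)")
    case True
    then show ?thesis unfolding L_E_P using i by (cases i) auto
  next
    case False
    then have "i \<noteq> j" by auto
    then show ?thesis unfolding L_E_P using i False by (cases i) auto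
  qed
  finally show "L ([:1, 1:] * E j * P i) = 1" .
qed

lemma K_reproducing: "degree v \<le> j \<Longrightarrow> L (K j * v) = poly v 1"
proof (rule reproducing_span)
  fix i assume i: "i \<le> j"
  show "L (K j * P i) = 1"
  proof (cases j)
    case 0
    then show ?thesis using i L_E_P[of 0 0] by (simp add: K_def)
  next
    case (Suc l)
    then have "L (K j * P i) = L (E j * P i) + L (E l * P i)"
      by (simp only: K_def distrib_right L_linear) (simp del: even_ker.simps)
    then show ?thesis using i Suc by (auto simp: L_E_P le_Suc_eq)
  qed
qed

text \<open>Askey's criterion: the product of off-diagonal coefficients
  \<open>al j * (1 - al (Suc j))\<close> is a quarter of 1 minus
  \<open>n (n - 2) / ((2 j + n - 2) (2 j + n))\<close>, hence nondecreasing in \<open>j\<close>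
  since \<open>2 \<le> n\<close>.\<close>

lemma E_mult_cone: "E i * E j \<in> pcone (range E)"
proof (rule askey_linearization[where A = "\<lambda>i. al (Suc i)" and C = "\<lambda>j. if j = 0 then 0 else 1 - al (Suc j)"])
  fix i j :: nat assume ij: "0 < i" "i \<le> j"
  have al_prod: "al j * (1 - al (Suc j)) =
      (1 - (real n * (real n - 2)) / ((2 * real j + real n - 2) * (2 * real j + real n))) / 4"
    if "0 < j" for j
  proof -
    define x y where "x = 2 * real j + real n - 2" and "y = 2 * real j + real n"
    have pos: "x > 0" "y > 0" using that n2 by (simp_all add: x_def y_def)
    have "al j * (1 - al (Suc j)) = real j / x * (1 - (real j + 1) / y)"
      by (simp add: geg_al_def x_def y_def)
    also have "\<dots> = real j * (y - (real j + 1)) / (x * y)"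
      using pos by (simp add: field_simps)
    also have "real j * (y - (real j + 1)) = (x * y - real n * (real n - 2)) / 4"
      by (simp add: x_def y_def algebra_simps)
    finally show ?thesis using pos unfolding x_def y_def by (simp add: diff_divide_distrib)
  qed
  have "(real n * (real n - 2)) / ((2 * real j + real n - 2) * (2 * real j + real n))
      \<le> (real n * (real n - 2)) / ((2 * real i + real n - 2) * (2 * real i + real n))"
    using ij n2 by (intro divide_left_mono mult_mono mult_pos_pos) auto
  then have "al i * (1 - al (Suc i)) \<le> al j * (1 - al (Suc j))"
    using al_prod[of i] al_prod[of j] ij by simp
  then show "al (Suc (i - 1)) * (if i = 0 then 0 else 1 - al (Suc i))
      \<le> al (Suc (j - 1)) * (if j = 0 then 0 else 1 - al (Suc j))"
    using ij by simp
qed (use al_pos al_less rec_E in \<open>auto simp: less_imp_le simp del: mult_pCons_left\<close>)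

lemma E_cone: "E j \<in> pcone (range P)"
proof (induction j rule: induct_nat_012[case_names 0 1 step])
  case 0
  show ?case by (rule pcone_base) (force intro: range_eqI[of _ _ 0])
next
  case 1
  then show ?case using dim_pos[of 1] unfolding even_ker.simps
    by (intro pcone_smult pcone_base rangeI) simp
next
  case (step j)
  then show ?case using dim_pos[of "Suc (Suc j)"] unfolding even_ker.simps
    by (intro pcone_add[OF step(1)] pcone_smult pcone_base rangeI) simp
qed

lemma K_cone_E: "K j \<in> pcone (range E)"
proof -
  have "E i \<in> pcone (range E)" for i by (rule pcone_base) (rule rangeI)
  then show ?thesis unfolding K_def by (simp add: pcone_add pcone.zero del: even_ker.simps)
qed

lemma cone_E_imp_cone_P: "f \<in> pcone (range E) \<Longrightarrow> f \<in> pcone (range P)"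
  using E_cone by (auto intro: pcone_trans)

lemma mult_cone_E: "f \<in> pcone (range E) \<Longrightarrow> g \<in> pcone (range E) \<Longrightarrow> f * g \<in> pcone (range E)"
  using E_mult_cone by (auto intro: pcone_mult)

text \<open>The recurrence of \<open>P\<close> has nonnegative coefficients and no diagonal term.
  This handles the factor coming from the node -1.\<close>

lemma mult_1_X_cone:
  assumes "f \<in> pcone (range P)"
  shows "[:1, 1:] * f \<in> pcone (range P)"
proof (rule pcone_mult[OF pcone_base[of _ "{[:1, 1:]}"] assms])
  fix a b assume "a \<in> {[:1, 1:] :: real poly}" "b \<in> range P"
  then obtain i where "b = P i" "a = [:1, 1:]" by auto
  then have "a * b = P i + X * P i" by simp
  also have "\<dots> \<in> pcone (range P)"
  proof -
    have "P j \<in> pcone (range P)" for j by (rule pcone_base) (rule rangeI)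
    moreover have "0 \<le> al i" using al_pos[of i] by (cases "i = 0") auto
    ultimately show ?thesis
      unfolding rec_P using al_less[of i] by (intro pcone_add pcone_smult) auto
  qed
  finally show "a * b \<in> pcone (range P)" .
qed simp

text \<open>Since \<open>w\<close> lies between 0 and \<open>b\<close>, the integrand
  \<open>b * w * u * u\<close> dominates the square of \<open>w * u\<close>, to which
  \<open>L_square_pos\<close> applies.\<close>

lemma L_weight_square_pos:
  assumes "\<And>t. -1 \<le> t \<Longrightarrow> t \<le> 1 \<Longrightarrow> 0 \<le> poly w t" "\<And>t. -1 \<le> t \<Longrightarrow> t \<le> 1 \<Longrightarrow> poly w t \<le> b"
    and "w \<noteq> 0" "u \<noteq> 0"
  shows "0 < L (w * u * u)"
proof -
  have "0 < L ((w * u) * (w * u))" using assms by (intro L_square_pos) simp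
  also have "0 \<le> L (smult b (w * u * u) - (w * u) * (w * u))"
  proof (rule L_nonneg)
    fix t :: real assume "-1 \<le> t" "t \<le> 1"
    then have "0 \<le> (b - poly w t) * poly w t * (poly u t)\<^sup>2"
      using assms(1,2)[of t] by simp
    then show "0 \<le> poly (smult b (w * u * u) - (w * u) * (w * u)) t"
      by (simp add: algebra_simps power2_eq_square)
  qed
  then have "L ((w * u) * (w * u)) \<le> b * L (w * u * u)" by (simp only: L_linear)
  finally have "0 < b * L (w * u * u)" .
  moreover have "0 \<le> b" using assms(1,2)[of 0] by simp
  ultimately show ?thesis by (simp add: zero_less_mult_iff)
qed

end

subsection \<open>Integration against the Gegenbauer measure\<close>

lemma gegenbauer_weight_nonneg: "0 \<le> gegenbauer_weight n t"
  by (simp add: gegenbauer_weight_def)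

lemma gegenbauer_weight_measurable [measurable]: "gegenbauer_weight n \<in> borel_measurable borel"
  unfolding gegenbauer_weight_def by measurable

lemma poly_borel_measurable [measurable]: "(\<lambda>t::real. poly p t) \<in> borel_measurable borel"
  by (intro borel_measurable_continuous_onI continuous_intros)

text \<open>The weight for \<open>n = 2\<close>, unbounded at the endpoints, which dominates the
  weights of all higher dimensions. Its antiderivative \<open>arcsin\<close> is continuous on the
  closed interval.\<close>

lemma arcsin_density_integrable:
  "set_integrable lborel {-1..1} (\<lambda>t::real. 1 / sqrt (1 - t\<^sup>2))"
proof -
  have "((\<lambda>t::real. 1 / sqrt (1 - t\<^sup>2)) has_integral arcsin 1 - arcsin (-1)) {-1..1}"
  proof (rule fundamental_theorem_of_calculus_interior)
    fix t :: real assume "t \<in> {-1<..<1}"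
    then have "(arcsin has_real_derivative inverse (sqrt (1 - t\<^sup>2))) (at t)"
      by (intro DERIV_arcsin) auto
    then show "(arcsin has_vector_derivative 1 / sqrt (1 - t\<^sup>2)) (at t)"
      by (simp add: has_real_derivative_iff_has_vector_derivative inverse_eq_divide)
  qed (auto intro: continuous_on_arcsin')
  then have "(\<lambda>t::real. 1 / sqrt (1 - t\<^sup>2)) absolutely_integrable_on {-1..1}"
    by (intro nonnegative_absolutely_integrable_1) (auto simp: has_integral_integrable abs_square_le_1)
  moreover have "(\<lambda>t::real. indicator {-1..1} t *\<^sub>R (1 / sqrt (1 - t\<^sup>2))) \<in> borel_measurable lborel"
    by measurable
  ultimately show ?thesis
    unfolding set_integrable_def by (simp add: integrable_completion)
qed

lemma gegenbauer_weight_poly_integrable: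
  assumes "2 \<le> n"
  shows "set_integrable lborel {-1..1} (\<lambda>t. gegenbauer_weight n t * poly p t)"
proof -
  have "bounded (poly p ` {-1..1})"
    by (intro compact_imp_bounded compact_continuous_image continuous_intros) simp
  then obtain B where B: "\<And>t. t \<in> {-1..1} \<Longrightarrow> \<bar>poly p t\<bar> \<le> B" "B > 0"
    unfolding bounded_pos by (auto simp del: atLeastAtMost_iff)
  \<comment> \<open>The exponent is at least -1/2 and the base is at most 1. At the endpoints both
    sides take the default value 0.\<close>
  have le: "gegenbauer_weight n t \<le> 1 / sqrt (1 - t\<^sup>2)" if "t \<in> {-1..1}" for t
  proof (cases "t\<^sup>2 = 1")
    case False
    have "t\<^sup>2 \<le> 1" using that by (simp add: abs_square_le_1 abs_le_iff)
    then have "0 < 1 - t\<^sup>2" "1 - t\<^sup>2 \<le> 1" using False by auto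
    then have "(1 - t\<^sup>2) powr ((real n - 3) / 2) \<le> (1 - t\<^sup>2) powr (- (1 / 2))"
      using assms by (intro powr_mono') auto
    also have "\<dots> = 1 / sqrt (1 - t\<^sup>2)"
      using \<open>0 < 1 - t\<^sup>2\<close> by (simp add: powr_minus powr_half_sqrt inverse_eq_divide)
    finally show ?thesis by (simp add: gegenbauer_weight_def)
  qed (simp add: gegenbauer_weight_def)
  show ?thesis
  proof (rule set_integrable_bound)
    show "set_integrable lborel {-1..1} (\<lambda>t. B * (1 / sqrt (1 - t\<^sup>2)))"
      using arcsin_density_integrable by (rule set_integrable_mult_right)
    show "set_borel_measurable lborel {-1..1} (\<lambda>t. gegenbauer_weight n t * poly p t)"
      unfolding set_borel_measurable_def by measurable
    show "AE t in lborel. t \<in> {-1..1} \<longrightarrow>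
        norm (gegenbauer_weight n t * poly p t) \<le> norm (B * (1 / sqrt (1 - t\<^sup>2)))"
    proof (intro AE_I2 impI)
      fix t :: real assume t: "t \<in> {-1..1}"
      have "\<bar>poly p t\<bar> * gegenbauer_weight n t \<le> B * (1 / sqrt (1 - t\<^sup>2))"
        using B(1)[OF t] B(2) le[OF t] gegenbauer_weight_nonneg[of n t] by (intro mult_mono) auto
      also have "\<dots> \<le> norm (B * (1 / sqrt (1 - t\<^sup>2)))"
        unfolding real_norm_def by (rule abs_ge_self)
      finally show "norm (gegenbauer_weight n t * poly p t) \<le> norm (B * (1 / sqrt (1 - t\<^sup>2)))"
        using gegenbauer_weight_nonneg[of n t] by (simp add: abs_mult mult.commute)
    qed
  qed
qed

definition gegenbauer_int :: "nat \<Rightarrow> real poly \<Rightarrow> real" where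
  "gegenbauer_int n p = (LINT t|gegenbauer_measure n. poly p t)"

lemma gegenbauer_weight_total_pos:
  assumes "2 \<le> n"
  shows "0 < (LINT t:{-1..1}|lborel. gegenbauer_weight n t)"
proof -
  have int: "integrable lborel (\<lambda>t. indicator {-1..1} t * gegenbauer_weight n t)"
    using gegenbauer_weight_poly_integrable[OF assms, of 1] by (simp add: set_integrable_def)
  have "(LINT t|lborel. indicator {-1..1} t * gegenbauer_weight n t) \<noteq> 0"
  proof
    assume "(LINT t|lborel. indicator {-1..1} t * gegenbauer_weight n t) = 0"
    then have "AE t in lborel. indicator {-1..1} t * gegenbauer_weight n t = 0"
      using int by (subst (asm) integral_nonneg_eq_0_iff_AE) (auto simp: gegenbauer_weight_nonneg)
    then have "AE t in lborel. t \<notin> {-1<..<1::real}"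
    proof eventually_elim
      case (elim t)
      show ?case
      proof
        assume t: "t \<in> {-1<..<1}"
        then have "t\<^sup>2 < 1" by (simp add: abs_square_less_1 abs_less_iff)
        then have "gegenbauer_weight n t > 0" by (simp add: gegenbauer_weight_def)
        then show False using elim t by (auto simp: indicator_def)
      qed
    qed
    then have "{-1<..<1::real} \<in> null_sets lborel"
      using AE_iff_null_sets[of "{-1<..<1::real}" lborel] by simp
    then show False by (auto simp: null_sets_def)
  qed
  moreover have "0 \<le> (LINT t|lborel. indicator {-1..1} t * gegenbauer_weight n t)"
    by (intro integral_nonneg_AE AE_I2) (auto simp: gegenbauer_weight_nonneg)
  ultimately show ?thesis by (simp add: set_lebesgue_integral_def)
qed

lemma gegenbauer_int_eq:
  assumes "2 \<le> n"
  shows "gegenbauer_int n p = (LINT t:{-1..1}|lborel. gegenbauer_weight n t * poly p t) /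
    (LINT t:{-1..1}|lborel. gegenbauer_weight n t)"
proof -
  define W where "W = (LINT s|restrict_space lborel {-1..1}. gegenbauer_weight n s)"
  have W: "W = (LINT t:{-1..1}|lborel. gegenbauer_weight n t)"
    by (simp add: W_def integral_restrict_space set_lebesgue_integral_def)
  have "gegenbauer_int n p =
      (LINT t|restrict_space lborel {-1..1}. (gegenbauer_weight n t / W) *\<^sub>R poly p t)"
    unfolding gegenbauer_int_def gegenbauer_measure_def W_def[symmetric]
  proof (rule integral_density)
    show "(\<lambda>t. gegenbauer_weight n t / W) \<in> borel_measurable (restrict_space lborel {-1..1})"
      by (rule measurable_restrict_space1) measurable
    show "poly p \<in> borel_measurable (restrict_space lborel {-1..1})"
      using poly_borel_measurable[of p] by (intro measurable_restrict_space1) simp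
    show "AE t in restrict_space lborel {-1..1}. 0 \<le> gegenbauer_weight n t / W"
      using gegenbauer_weight_total_pos[OF assms] gegenbauer_weight_nonneg by (simp add: W)
  qed
  also have "\<dots> = (LINT t:{-1..1}|lborel. gegenbauer_weight n t * poly p t / W)"
    by (simp add: integral_restrict_space set_lebesgue_integral_def)
  finally show ?thesis by (simp add: W)
qed

text \<open>The integrand is the derivative of \<open>F\<close>, which vanishes at both endpoints.
  There \<open>F\<close> is continuous but need not be differentiable, whence the interior form of
  the fundamental theorem.\<close>

lemma gegenbauer_weight_ibp:
  assumes "2 \<le> n"
  shows "(LINT t:{-1..1}|lborel. gegenbauer_weight n t *
    poly ([:1, 0, -1:] * pderiv p - smult (real n - 1) ([:0, 1:] * p)) t) = 0"
    (is "(LINT t:_|_. ?f t) = 0")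
proof -
  define F where "F t = (1 - t\<^sup>2) powr ((real n - 1) / 2) * poly p t" for t :: real
  have "(?f has_integral F 1 - F (-1)) {-1..1}"
  proof (rule fundamental_theorem_of_calculus_interior)
    show "continuous_on {-1..1} F"
      unfolding F_def using assms
      by (intro continuous_intros continuous_on_powr') (auto simp: abs_square_le_1)
  next
    fix t :: real assume t: "t \<in> {-1<..<1}"
    then have pos: "0 < 1 - t\<^sup>2" by (simp add: abs_square_less_1 abs_less_iff)
    have "((\<lambda>t. 1 - t\<^sup>2) has_real_derivative - 2 * t) (at t)"
      by (auto intro!: derivative_eq_intros)
    from DERIV_fun_powr[OF this pos, of "(real n - 1) / 2"]
    have "((\<lambda>t. (1 - t\<^sup>2) powr ((real n - 1) / 2)) has_real_derivative
        (real n - 1) / 2 * gegenbauer_weight n t * (- 2 * t)) (at t)"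
      by (simp add: gegenbauer_weight_def field_simps)
    from DERIV_mult[OF this poly_DERIV[of p t]]
    have "(F has_real_derivative (real n - 1) / 2 * gegenbauer_weight n t * (- 2 * t) * poly p t
        + poly (pderiv p) t * (1 - t\<^sup>2) powr ((real n - 1) / 2)) (at t)"
      unfolding F_def .
    moreover have "(1 - t\<^sup>2) powr ((real n - 1) / 2) = (1 - t\<^sup>2) * gegenbauer_weight n t"
    proof -
      have "(real n - 1) / 2 = 1 + (real n - 3) / 2" by (simp add: field_simps)
      then have "(1 - t\<^sup>2) powr ((real n - 1) / 2) = (1 - t\<^sup>2) powr 1 * (1 - t\<^sup>2) powr ((real n - 3) / 2)"
        by (simp only: powr_add)
      then show ?thesis using pos by (simp add: gegenbauer_weight_def)
    qed
    moreover have "(real n - 1) / 2 * gegenbauer_weight n t * (- 2 * t) * poly p t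
        + poly (pderiv p) t * ((1 - t\<^sup>2) * gegenbauer_weight n t) = ?f t"
      by (simp add: field_simps power2_eq_square)
    ultimately show "(F has_vector_derivative ?f t) (at t)"
      by (simp only: has_real_derivative_iff_has_vector_derivative)
  qed simp
  then have "integral {-1..1} ?f = 0" by (simp add: F_def integral_unique)
  then show ?thesis
    using set_borel_integral_eq_integral(2)[OF gegenbauer_weight_poly_integrable[OF assms]] by metis
qed

lemma gegenbauer_functional_int:
  assumes "2 \<le> n"
  shows "gegenbauer_functional n (gegenbauer_int n)"
proof
  note int = gegenbauer_weight_poly_integrable[OF assms]
  note eq = gegenbauer_int_eq[OF assms]
  note pos = gegenbauer_weight_total_pos[OF assms]
  show add: "gegenbauer_int n (p + q) = gegenbauer_int n p + gegenbauer_int n q" for p q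
    using set_integral_add(2)[OF int[of p] int[of q]]
    by (simp add: eq distrib_left add_divide_distrib)
  show smult: "gegenbauer_int n (smult c p) = c * gegenbauer_int n p" for c p
    using set_integral_mult_right[of lborel "{-1..1}" c "\<lambda>t. gegenbauer_weight n t * poly p t"]
    by (simp add: eq mult.left_commute)
  show "gegenbauer_int n 1 = 1" using pos by (simp add: eq)
  show "0 \<le> gegenbauer_int n p" if "\<And>t. -1 \<le> t \<Longrightarrow> t \<le> 1 \<Longrightarrow> 0 \<le> poly p t" for p
  proof -
    have "0 \<le> (LINT t:{-1..1}|lborel. gegenbauer_weight n t * poly p t)"
      unfolding set_lebesgue_integral_def using that gegenbauer_weight_nonneg[of n]
      by (intro integral_nonneg_AE AE_I2) (auto simp: indicator_def)
    then show ?thesis using pos by (simp add: eq)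
  qed
  show "gegenbauer_int n ([:1, 0, -1:] * pderiv p) = (real n - 1) * gegenbauer_int n ([:0, 1:] * p)" for p
  proof -
    have "gegenbauer_int n ([:1, 0, -1:] * pderiv p - smult (real n - 1) ([:0, 1:] * p)) = 0"
      using gegenbauer_weight_ibp[OF assms, of p] unfolding eq by simp
    moreover have "[:1, 0, -1:] * pderiv p = ([:1, 0, -1:] * pderiv p - smult (real n - 1) ([:0, 1:] * p))
        + smult (real n - 1) ([:0, 1:] * p)"
      by simp
    ultimately show ?thesis by (metis add smult add_0)
  qed
qed (fact assms)

text \<open>Uniqueness: subtracting from \<open>Q i\<close> the multiple of \<open>geg n i\<close>
  with the same leading coefficient leaves a polynomial of lower degree that is orthogonal to both,
  hence to itself. The value at 1 fixes the multiple.\<close>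

lemma gegenbauer_eq_geg:
  assumes "2 \<le> n"
  shows "gegenbauer n = geg n"
proof -
  interpret gegenbauer_functional n "gegenbauer_int n" by (rule gegenbauer_functional_int[OF assms])
  have int: "(LINT t|gegenbauer_measure n. poly p t * poly q t) = gegenbauer_int n (p * q)" for p q
    by (simp add: gegenbauer_int_def)
  show ?thesis
    unfolding gegenbauer_def int
  proof (rule the_equality)
    show "(\<forall>i. degree (geg n i) = i \<and> poly (geg n i) 1 = 1) \<and>
        (\<forall>i j. i \<noteq> j \<longrightarrow> gegenbauer_int n (geg n i * geg n j) = 0)"
      using degree_P P_1 orth' by blast
  next
    fix Q
    assume Q: "(\<forall>i. degree (Q i) = i \<and> poly (Q i) 1 = 1) \<and>
        (\<forall>i j. i \<noteq> j \<longrightarrow> gegenbauer_int n (Q i * Q j) = 0)"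
    then have Q0: "Q i \<noteq> 0" for i by (metis poly_0 zero_neq_one)
    have orth_lower: "gegenbauer_int n (R i * v) = 0"
      if R: "\<And>i. degree (R i) = i" "\<And>i. R i \<noteq> 0"
        "\<And>i j. i \<noteq> j \<Longrightarrow> gegenbauer_int n (R i * R j) = 0" and v: "degree v < i" for R v i
    proof -
      obtain c where c: "v = (\<Sum>j\<le>i - 1. smult (c j) (R j))"
        using span_by_degree[OF R(1,2), of v "i - 1"] v by (metis less_Suc_eq_le Suc_pred' less_imp_Suc_add zero_less_Suc)
      show ?thesis
        unfolding c sum_distrib_left mult_smult_right L_linear
        using R(3) v by (intro sum.neutral) auto
    qed
    show "Q = geg n"
    proof
      fix i
      define a where "a = lead_coeff (Q i) / lead_coeff (geg n i)"
      define v where "v = Q i - smult a (geg n i)"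
      have "v = 0"
      proof (rule ccontr)
        assume v: "v \<noteq> 0"
        have "coeff (geg n i) i \<noteq> 0"
          using P_nonzero[of i] leading_coeff_neq_0[of "geg n i"] unfolding degree_P by blast
        then have cf: "coeff v i = 0"
          using Q by (simp add: v_def a_def degree_P)
        have "degree v \<le> i"
          unfolding v_def using Q degree_P[of i] by (intro degree_diff_le) auto
        then have d: "degree v < i"
          using cf v by (metis leading_coeff_0_iff le_neq_implies_less)
        have "gegenbauer_int n (Q i * v) = 0"
          by (rule orth_lower[OF _ _ _ d]) (use Q Q0 in auto)
        moreover have "gegenbauer_int n (geg n i * v) = 0"
          by (rule orth_lower[OF _ _ _ d]) (use degree_P P_nonzero orth' in auto)
        moreover have "v * v = Q i * v - smult a (geg n i * v)"
          by (rule poly_eqI_real) (simp add: v_def algebra_simps)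
        ultimately have "gegenbauer_int n (v * v) = 0"
          by (simp only: L_linear)
        then show False using L_square_pos[OF v] by simp
      qed
      then have eq: "Q i = smult a (geg n i)" by (simp add: v_def)
      from arg_cong[OF this, of "\<lambda>p. poly p 1"] have "a = 1"
        using Q P_1[of i] by simp
      then show "Q i = geg n i" using eq by simp
    qed
  qed
qed

subsection \<open>Newton interpolation of absolutely monotone functions\<close>

text \<open>The part of \<open>absolutely_monotone\<close> inherited by divided differences, which
  may vanish identically and need no value at 1.\<close>

definition am_derivs :: "(nat \<Rightarrow> real \<Rightarrow> real) \<Rightarrow> bool" where
  "am_derivs d \<longleftrightarrow> (\<forall>t\<in>{-1..<1}. \<forall>i.
     (d i has_real_derivative d (Suc i) t) (at t within {-1..<1}) \<and> 0 \<le> d i t)"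

text \<open>
  The divided difference is the integral of \<open>d 1 (z + s (t - z))\<close> over \<open>s\<close> from 0 to 1,
  which is again absolutely monotone in \<open>t\<close>.
\<close>

lemma am_derivs_divided_difference:
  assumes d: "am_derivs d" and z: "z \<in> {-1..<1}"
  obtains d' where "am_derivs d'" "\<And>t. t \<in> {-1..<1} \<Longrightarrow> d 0 t = d 0 z + (t - z) * d' 0 t"
proof -
  let ?U = "{-1..<1::real}"
  have der: "(d i has_real_derivative d (Suc i) t) (at t within ?U)" and nonneg: "0 \<le> d i t"
    if "t \<in> ?U" for i t
    using d that by (auto simp: am_derivs_def)
  have mem: "z + s * (t - z) \<in> ?U" if "s \<in> {0..1}" "t \<in> ?U" for s t
  proof -
    have "(1 - s) *\<^sub>R z + s *\<^sub>R t \<in> ?U"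
      using that z by (intro convexD) auto
    then show ?thesis by (simp add: algebra_simps)
  qed
  have cont: "continuous_on ?U (d i)" for i
    using der by (intro DERIV_continuous_on) auto
  have contd: "continuous_on (?U \<times> {0..1}) (\<lambda>x. snd x ^ i * d j (z + snd x * (fst x - z)))" for i j
    by (intro continuous_intros continuous_on_compose2[OF cont]) (auto intro: mem)
  have cont1: "continuous_on {0..1} (\<lambda>s. s ^ i * d j (z + s * (t - z)))" if "t \<in> ?U" for i j t
    using that by (intro continuous_intros continuous_on_compose2[OF cont]) (auto intro: mem)
  \<comment> \<open>Differentiating \<open>i\<close> times under the integral sign produces the
    factor \<open>s ^ i\<close>.\<close>
  define d' where "d' i t = integral {0..1} (\<lambda>s. s ^ i * d (Suc i) (z + s * (t - z)))" for i t
  have "am_derivs d'"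
    unfolding am_derivs_def
  proof (intro ballI allI conjI)
    fix t i assume t: "t \<in> ?U"
    have "((\<lambda>t. integral (cbox 0 1) (\<lambda>s. s ^ i * d (Suc i) (z + s * (t - z)))) has_field_derivative
        integral (cbox 0 1) (\<lambda>s. s ^ Suc i * d (Suc (Suc i)) (z + s * (t - z)))) (at t within ?U)"
    proof (rule leibniz_rule_field_derivative)
      fix x s :: real assume x: "x \<in> ?U" and s: "s \<in> cbox 0 1"
      have "((\<lambda>x. z + s * (x - z)) has_real_derivative s) (at x within ?U)"
        by (auto intro!: derivative_eq_intros)
      moreover have "(d (Suc i) has_real_derivative d (Suc (Suc i)) (z + s * (x - z)))
          (at (z + s * (x - z)) within (\<lambda>x. z + s * (x - z)) ` ?U)"
      proof (rule DERIV_subset[OF der])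
        show "z + s * (x - z) \<in> ?U" using x s by (intro mem) auto
        show "(\<lambda>x. z + s * (x - z)) ` ?U \<subseteq> ?U" using s by (intro image_subsetI mem) auto
      qed
      ultimately have "((\<lambda>x. d (Suc i) (z + s * (x - z))) has_real_derivative
          d (Suc (Suc i)) (z + s * (x - z)) * s) (at x within ?U)"
        using DERIV_image_chain by (fastforce simp: o_def)
      from DERIV_cmult[OF this, of "s ^ i"]
      show "((\<lambda>x. s ^ i * d (Suc i) (z + s * (x - z))) has_real_derivative
          s ^ Suc i * d (Suc (Suc i)) (z + s * (x - z))) (at x within ?U)"
        by (simp add: mult_ac)
    next
      fix x assume "x \<in> ?U"
      then show "(\<lambda>s. s ^ i * d (Suc i) (z + s * (x - z))) integrable_on cbox 0 1"
        unfolding box_real by (intro integrable_continuous_real cont1)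
    next
      show "continuous_on (?U \<times> cbox 0 1) (\<lambda>(x, s). s ^ Suc i * d (Suc (Suc i)) (z + s * (x - z)))"
        using contd[of "Suc i" "Suc (Suc i)"] by (simp add: case_prod_unfold box_real)
    qed (use t in auto)
    then show "(d' i has_real_derivative d' (Suc i) t) (at t within ?U)"
      unfolding d'_def box_real .
    show "0 \<le> d' i t"
      unfolding d'_def
      by (intro integral_nonneg integrable_continuous_real cont1 t) (auto intro!: mult_nonneg_nonneg nonneg mem t)
  qed
  moreover have "d 0 t = d 0 z + (t - z) * d' 0 t" if t: "t \<in> ?U" for t
  proof -
    have "((\<lambda>s. (t - z) * d (Suc 0) (z + s * (t - z))) has_integral
        d 0 (z + 1 * (t - z)) - d 0 (z + 0 * (t - z))) {0..1}"
    proof (rule fundamental_theorem_of_calculus)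
      fix s :: real assume s: "s \<in> {0..1}"
      have "((\<lambda>s. z + s * (t - z)) has_real_derivative t - z) (at s within {0..1})"
        by (auto intro!: derivative_eq_intros)
      moreover have "(d 0 has_real_derivative d (Suc 0) (z + s * (t - z)))
          (at (z + s * (t - z)) within (\<lambda>s. z + s * (t - z)) ` {0..1})"
      proof (rule DERIV_subset[OF der])
        show "z + s * (t - z) \<in> ?U" by (rule mem[OF s t])
        show "(\<lambda>s. z + s * (t - z)) ` {0..1} \<subseteq> ?U" using mem[OF _ t] by (intro image_subsetI)
      qed
      ultimately have "((\<lambda>s. d 0 (z + s * (t - z))) has_real_derivative
          d (Suc 0) (z + s * (t - z)) * (t - z)) (at s within {0..1})"
        using DERIV_image_chain by (fastforce simp: o_def)
      then show "((\<lambda>s. d 0 (z + s * (t - z))) has_vector_derivative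
          (t - z) * d (Suc 0) (z + s * (t - z))) (at s within {0..1})"
        by (simp add: has_real_derivative_iff_has_vector_derivative mult.commute)
    qed simp
    from integral_unique[OF this]
    have "(t - z) * integral {0..1} (\<lambda>s. d (Suc 0) (z + s * (t - z))) = d 0 t - d 0 z"
      by simp
    then show ?thesis by (simp add: d'_def)
  qed
  ultimately show ?thesis using that by blast
qed

text \<open>Each step takes a divided difference at the next node. Since that function is also
  defined at the node itself, nodes may repeat, and Hermite interpolation is covered without
  mentioning derivatives of the interpolant.\<close>

lemma am_newton:
  fixes z :: "nat \<Rightarrow> real"
  assumes d: "am_derivs d" and z: "\<And>i. i < m \<Longrightarrow> z i \<in> {-1..<1}"
  shows "\<exists>a R. (\<forall>i. 0 \<le> a i) \<and> (\<forall>t\<in>{-1..<1}. 0 \<le> R t \<and>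
    d 0 t = (\<Sum>i<m. a i * (\<Prod>j<i. t - z j)) + R t * (\<Prod>j<m. t - z j))"
proof -
  \<comment> \<open>The induction carries absolute monotonicity of the remainder factor, not only
    its sign.\<close>
  have "\<exists>a e. am_derivs e \<and> (\<forall>i. 0 \<le> a i) \<and> (\<forall>t\<in>{-1..<1}.
    d 0 t = (\<Sum>i<m. a i * (\<Prod>j<i. t - z j)) + e 0 t * (\<Prod>j<m. t - z j))"
    using z
  proof (induction m)
    case 0
    show ?case using d by (intro exI[of _ "\<lambda>_. 0"] exI[of _ d]) simp
  next
    case (Suc m)
    have "z i \<in> {-1..<1}" if "i < m" for i
      using Suc.prems that by simp
    from Suc.IH[OF this] obtain a e where e: "am_derivs e" "\<forall>i. 0 \<le> a i" and
      eq: "\<And>t. t \<in> {-1..<1} \<Longrightarrow>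
        d 0 t = (\<Sum>i<m. a i * (\<Prod>j<i. t - z j)) + e 0 t * (\<Prod>j<m. t - z j)"
      by blast
    obtain e' where e': "am_derivs e'" "\<And>t. t \<in> {-1..<1} \<Longrightarrow> e 0 t = e 0 (z m) + (t - z m) * e' 0 t"
      using am_derivs_divided_difference[OF e(1), of "z m"] Suc.prems by blast
    have "0 \<le> e 0 (z m)" using e(1) Suc.prems[of m] unfolding am_derivs_def by blast
    moreover have "d 0 t = (\<Sum>i<Suc m. (a(m := e 0 (z m))) i * (\<Prod>j<i. t - z j))
        + e' 0 t * (\<Prod>j<Suc m. t - z j)" if t: "t \<in> {-1..<1}" for t
    proof -
      have "(\<Sum>i<m. (a(m := e 0 (z m))) i * (\<Prod>j<i. t - z j)) = (\<Sum>i<m. a i * (\<Prod>j<i. t - z j))"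
        by (rule sum.cong) auto
      moreover have "S + (c + (t - z m) * r) * q = S + c * q + r * (q * (t - z m))" for S c r q :: real
        by (simp add: algebra_simps)
      ultimately show ?thesis
        by (simp only: eq[OF t] e'(2)[OF t] sum.lessThan_Suc prod.lessThan_Suc fun_upd_same)
    qed
    ultimately show ?case
      using e(2) e'(1) by (intro exI[of _ "a(m := e 0 (z m))"] exI[of _ e']) auto
  qed
  then obtain a e where *: "am_derivs e" "\<forall>i. 0 \<le> a i" "\<forall>t\<in>{-1..<1}.
    d 0 t = (\<Sum>i<m. a i * (\<Prod>j<i. t - z j)) + e 0 t * (\<Prod>j<m. t - z j)" by blast
  then show ?thesis
    by (intro exI[of _ a] exI[of _ "e 0"]) (auto simp: am_derivs_def)
qed

subsection \<open>Quadrature nodes\<close>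

lemma prod_linear:
  fixes Z :: "real set"
  assumes "finite Z"
  shows "degree (\<Prod>z\<in>Z. [:- z, 1:]) = card Z" "(\<Prod>z\<in>Z. [:- z, 1:]) \<noteq> 0"
  using assms by (simp_all add: degree_prod_eq_sum_degree)

text \<open>Division by the node polynomial leaves a remainder given by Lagrange interpolation, and
  \<open>M\<close> annihilates the rest. The weights are the values of \<open>M\<close> at the
  Lagrange basis polynomials.\<close>

lemma lagrange_functional:
  fixes M :: "real poly \<Rightarrow> real"
  assumes add: "\<And>p q. M (p + q) = M p + M q" and smult: "\<And>c p. M (smult c p) = c * M p"
    and Z: "finite Z" "card Z \<le> m"
    and zero: "\<And>v. degree v + card Z \<le> m \<Longrightarrow> M ((\<Prod>z\<in>Z. [:- z, 1:]) * v) = 0"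
  shows "\<exists>\<rho>. \<forall>f. degree f \<le> m \<longrightarrow> M f = (\<Sum>z\<in>Z. \<rho> z * poly f z)"
proof -
  define Q where "Q = (\<Prod>z\<in>Z. [:- z, 1:])"
  define l where "l z = (\<Prod>y\<in>Z - {z}. smult (1 / (z - y)) [:- y, 1:])" for z
  have M_0: "M 0 = 0" using smult[of 0 0] by simp
  have M_sum: "M (sum f I) = (\<Sum>i\<in>I. M (f i))" for f and I :: "real set"
    by (induction I rule: infinite_finite_induct) (auto simp: M_0 add)
  have Q: "degree Q = card Z" "Q \<noteq> 0"
    unfolding Q_def using prod_linear[OF Z(1)] by auto
  have poly_l: "poly (l z) x = (if x = z then 1 else 0)" if "x \<in> Z" "z \<in> Z" for x z
  proof (cases "x = z")
    case True
    then show ?thesis by (auto simp: l_def poly_prod simp flip: diff_divide_distrib intro!: prod.neutral)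
  next
    case False
    then show ?thesis using that Z by (auto simp: l_def poly_prod prod_zero_iff)
  qed
  have degree_l: "degree (l z) < card Z" if "z \<in> Z" for z
  proof -
    have "degree (l z) \<le> (\<Sum>y\<in>Z - {z}. degree (smult (1 / (z - y)) [:- y, 1:]))"
      unfolding l_def using degree_prod_sum_le[of "Z - {z}" "\<lambda>y. smult (1 / (z - y)) [:- y, 1:]"] Z
      by (simp add: o_def)
    also have "\<dots> \<le> (\<Sum>y\<in>Z - {z}. 1)" by (intro sum_mono) (auto intro: order_trans[OF degree_smult_le])
    also have "\<dots> = card Z - 1" using that Z by simp
    also have "\<dots> < card Z" using that Z card_gt_0_iff[of Z] by auto
    finally show ?thesis .
  qed
  have "M f = (\<Sum>z\<in>Z. M (l z) * poly f z)" if f: "degree f \<le> m" for f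
  proof -
    define v R where "v = f div Q" and "R = f mod Q"
    have f_eq: "f = Q * v + R" by (simp add: v_def R_def)
    have R: "R = (\<Sum>z\<in>Z. smult (poly f z) (l z))"
    proof (cases "Z = {}")
      case True
      then show ?thesis by (simp add: R_def Q_def)
    next
      case False
      then have pos: "0 < card Z" using Z by (simp add: card_gt_0_iff)
      have dR: "degree R < card Z"
        using degree_mod_less[OF Q(2), of f] pos Q(1) by (auto simp: R_def)
      have dS: "degree (\<Sum>z\<in>Z. smult (poly f z) (l z)) < card Z"
        using degree_l pos by (intro degree_sum_less) (auto intro: le_less_trans[OF degree_smult_le])
      have "poly R x = poly (\<Sum>z\<in>Z. smult (poly f z) (l z)) x" if "x \<in> Z" for x
      proof -
        have "poly Q x = 0" using that Z by (auto simp: Q_def poly_prod prod_zero_iff)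
        then have "poly R x = poly f x" using arg_cong[OF f_eq, of "\<lambda>p. poly p x"] by simp
        also have "\<dots> = (\<Sum>z\<in>Z. if x = z then poly f z else 0)"
          using that Z by simp
        also have "\<dots> = poly (\<Sum>z\<in>Z. smult (poly f z) (l z)) x"
          unfolding poly_sum using that by (intro sum.cong) (auto simp: poly_l)
        finally show ?thesis .
      qed
      then show ?thesis
        using dR dS by (intro poly_eqI_degree[of Z]) auto
    qed
    have "degree v + card Z \<le> m"
    proof (cases "v = 0")
      case False
      have "degree R \<le> m"
        using degree_mod_less[OF Q(2), of f] Q(1) Z(2) by (auto simp: R_def)
      then have "degree (f - R) \<le> m" using f by (intro degree_diff_le)
      moreover have "f - R = Q * v" using f_eq by simp
      ultimately show ?thesis using degree_mult_eq[OF Q(2) False] Q(1) by simp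
    qed (use Z in simp)
    then have "M (Q * v) = 0" using zero by (simp add: Q_def)
    then have "M f = M R" by (subst f_eq) (simp add: add)
    also have "\<dots> = (\<Sum>z\<in>Z. M (l z) * poly f z)"
      unfolding R M_sum smult by (intro sum.cong refl mult.commute)
    finally show ?thesis .
  qed
  then show ?thesis by (intro exI[of _ "\<lambda>z. M (l z)"] allI impI)
qed

section \<open>Gauss nodes for integration with the mass \<open>1/N\<close> at the point 1
  removed\<close>

context gegenbauer_functional
begin

definition LN :: "real \<Rightarrow> real poly \<Rightarrow> real" where
  "LN N p = L p - poly p 1 / N"

lemma LN_add: "LN N (p + q) = LN N p + LN N q"
  by (simp add: LN_def L_linear add_divide_distrib)

lemma LN_diff: "LN N (p - q) = LN N p - LN N q"
  by (simp add: LN_def L_linear diff_divide_distrib)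

lemma LN_smult: "LN N (smult c p) = c * LN N p"
  by (simp add: LN_def L_linear algebra_simps)

text \<open>Cauchy--Schwarz against the reproducing kernel \<open>F\<close> of the point 1.\<close>

lemma LN_square_pos:
  assumes w: "\<And>t. -1 \<le> t \<Longrightarrow> t \<le> 1 \<Longrightarrow> 0 \<le> poly w t" "\<And>t. -1 \<le> t \<Longrightarrow> t \<le> 1 \<Longrightarrow> poly w t \<le> b"
      "w \<noteq> 0"
    and rep: "\<And>v. degree v \<le> m \<Longrightarrow> L (w * F * v) = poly v 1"
    and F: "degree F \<le> m" "0 < poly F 1"
    and N: "poly w 1 * poly F 1 < N" "0 < N"
    and u: "u \<noteq> 0" "degree u \<le> m"
  shows "0 < LN N (w * u * u)"
proof -
  define s x where "s = poly F 1" and "x = poly u 1"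
  \<comment> \<open>In the inner product with weight \<open>w\<close>, \<open>F\<close> has squared
    norm \<open>s\<close> and pairs with \<open>u\<close> to \<open>x\<close>, so this removes from
    \<open>u\<close> its projection onto \<open>F\<close>.\<close>
  define v where "v = u - smult (x / s) F"
  have s: "0 < s" using F by (simp add: s_def)
  have Luu: "0 < L (w * u * u)" using L_weight_square_pos[OF w u(1)] .
  have "0 \<le> L (w * v * v)"
    using L_weight_square_pos[OF w, of v] L_0 by (cases "v = 0") auto
  also have "w * v * v = w * u * u - smult (2 * (x / s)) (w * F * u) + smult ((x / s)\<^sup>2) (w * F * F)"
    by (rule poly_eqI_real) (simp add: v_def algebra_simps power2_eq_square)
  also have "L \<dots> = L (w * u * u) - 2 * (x / s) * x + (x / s)\<^sup>2 * s"
    unfolding L_linear using rep[OF u(2)] rep[OF F(1)] by (simp add: s_def x_def)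
  also have "\<dots> = L (w * u * u) - x\<^sup>2 / s"
    using s by (simp add: power2_eq_square)
  finally have ge: "x\<^sup>2 / s \<le> L (w * u * u)" by simp
  have "poly (w * u * u) 1 / N < L (w * u * u)"
  proof (cases "x = 0")
    case True
    then show ?thesis using Luu by (simp add: x_def)
  next
    case False
    have "poly w 1 / N < 1 / s"
      using s N by (simp add: s_def field_simps)
    then have "x\<^sup>2 * (poly w 1 / N) < x\<^sup>2 * (1 / s)"
      using False by (intro mult_strict_left_mono) auto
    then have "poly (w * u * u) 1 / N < x\<^sup>2 / s"
      by (simp add: x_def power2_eq_square algebra_simps)
    then show ?thesis using ge by simp
  qed
  then show ?thesis by (simp add: LN_def)
qed

text \<open>
  The nodes are the zeros of \<open>F k + c F (k-1)\<close>, where orthogonality for \<open>LN N\<close> forces the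
  value of \<open>c\<close>; the bounds on \<open>N\<close> amount to \<open>c \<ge> 0\<close>.
\<close>

lemma gauss_nodes:
  assumes jac: "jacobi F A B C k" and k: "0 < k"
    and w: "\<And>t. -1 \<le> t \<Longrightarrow> t \<le> 1 \<Longrightarrow> 0 \<le> poly w t" "\<And>t. -1 \<le> t \<Longrightarrow> t \<le> 1 \<Longrightarrow> poly w t \<le> b"
      "w \<noteq> 0"
    and rep: "\<And>j v. degree v \<le> j \<Longrightarrow> L (w * F j * v) = poly v 1"
    and F_1: "\<And>j. 0 < poly (F j) 1"
    and N: "poly w 1 * poly (F (k - 1)) 1 < N" "N \<le> poly w 1 * poly (F k) 1" "0 < N"
    and plus: "\<And>u. u \<noteq> 0 \<Longrightarrow> degree u < k \<Longrightarrow> 0 < LN N ([:1, 1:] * w * u * u)"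
  obtains \<alpha> where "strict_mono_on {..<k} \<alpha>" "\<And>i. i < k \<Longrightarrow> -1 < \<alpha> i \<and> \<alpha> i < 1"
    "\<And>v. degree v < k \<Longrightarrow> LN N (w * (\<Prod>i<k. [:- \<alpha> i, 1:]) * v) = 0"
    "\<And>s. s \<le> k \<Longrightarrow> (\<Prod>i<s. [:- \<alpha> i, 1:]) \<in> pcone (range F)"
proof -
  define c where "c = (poly w 1 * poly (F k) 1 - N) / (N - poly w 1 * poly (F (k - 1)) 1)"
  have c: "0 \<le> c" using N by (simp add: c_def)
  \<comment> \<open>Against \<open>w * q * v\<close> the integral contributes
    \<open>(1 + c) * v(1)\<close> and the point mass \<open>w(1) * q(1) * v(1) / N\<close>; this
    equation makes them cancel.\<close>
  have c_eq: "(1 + c) * N = poly w 1 * (poly (F k) 1 + c * poly (F (k - 1)) 1)"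
  proof -
    have "c * (N - poly w 1 * poly (F (k - 1)) 1) = poly w 1 * poly (F k) 1 - N"
      using N by (simp add: c_def)
    then show ?thesis by (simp add: algebra_simps)
  qed
  define q where "q = F k + smult c (F (k - 1))"
  have LN_q: "LN N (w * q * v) = 0" if "degree v < k" for v
  proof -
    have "w * q * v = w * F k * v + smult c (w * F (k - 1) * v)"
      by (simp add: q_def algebra_simps)
    then have "L (w * q * v) = (1 + c) * poly v 1"
      using rep[of v k] rep[of v "k - 1"] that by (simp add: L_linear algebra_simps)
    moreover have "poly (w * q * v) 1 = (1 + c) * N * poly v 1"
      unfolding c_eq by (simp add: q_def)
    ultimately have "poly (w * q * v) 1 / N = L (w * q * v)"
      using N(3) by (simp only:) simp
    then show ?thesis by (simp add: LN_def del: poly_mult)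
  qed
  define p where "p = F(k := q)"
  have jac': "jacobi p A (B(k - 1 := B (k - 1) - A (k - 1) * c)) C k"
    unfolding p_def q_def by (rule jacobi_change_top[OF jac k])
  obtain \<alpha> where \<alpha>: "strict_mono_on {..<k} \<alpha>" "p k = smult (lead_coeff (p k)) (\<Prod>i<k. [:- \<alpha> i, 1:])"
      "\<And>s. s \<le> k \<Longrightarrow> (\<Prod>i<s. [:- \<alpha> i, 1:]) \<in> pcone (p ` {..k})"
    using jacobi_partial_products[OF jac'] by blast
  define g where "g = (\<Prod>i<k. [:- \<alpha> i, 1:])"
  have lc: "0 < lead_coeff (p k)" using jacobi.lead_coeff_pos[OF jac'] by simp
  have LN_g: "LN N (w * g * v) = 0" if "degree v < k" for v
  proof -
    have "q = smult (lead_coeff (p k)) g" using \<alpha>(2) by (simp add: p_def g_def)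
    then have "w * q * v = smult (lead_coeff (p k)) (w * g * v)" by simp
    then have "lead_coeff (p k) * LN N (w * g * v) = 0"
      using LN_q[OF that] by (metis LN_smult)
    then show ?thesis using lc by (metis less_irrefl mult_eq_0_iff)
  qed
  have "-1 < \<alpha> i \<and> \<alpha> i < 1" if i: "i < k" for i
  proof -
    \<comment> \<open>The test polynomial for the node \<open>\<alpha> i\<close> omits its factor,
      so that \<open>LN N\<close> kills \<open>(t - \<alpha> i) w u u\<close>. Writing
      \<open>1 - t\<close> and \<open>1 + t\<close> in terms of \<open>t - \<alpha> i\<close> then
      gives the signs of \<open>1 - \<alpha> i\<close> and \<open>1 + \<alpha> i\<close>.\<close>
    define u where "u = (\<Prod>j\<in>{..<k} - {i}. [:- \<alpha> j, 1:])"
    have g: "g = [:- \<alpha> i, 1:] * u"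
      unfolding g_def u_def using i by (intro prod.remove) auto
    have "degree u = k - 1" unfolding u_def using i by (subst degree_prod_eq_sum_degree) auto
    then have du: "degree u < k" "degree u \<le> k - 1" using k by auto
    have u0: "u \<noteq> 0" by (simp add: u_def)
    have "LN N (w * ([:- \<alpha> i, 1:] * u) * u) = 0" using LN_g[OF du(1)] by (simp only: g)
    moreover have "w * ([:- \<alpha> i, 1:] * u) * u = [:- \<alpha> i, 1:] * (w * u * u)"
      by (simp only: mult_ac)
    ultimately have zero: "LN N ([:- \<alpha> i, 1:] * (w * u * u)) = 0" by simp
    have pos: "0 < LN N (w * u * u)"
    proof (rule LN_square_pos[OF w])
      show "degree (F (k - 1)) \<le> k - 1"
        using jacobi.degree_lead_coeff[OF jac, of "k - 1"] by simp
    qed (use rep F_1 N u0 du in auto)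
    \<comment> \<open>The factor \<open>1 - t\<close> vanishes at 1, so the point mass does not
      matter and \<open>LN N\<close> agrees with \<open>L\<close>.\<close>
    have minus: "0 < LN N ([:1, -1:] * w * u * u)"
    proof -
      have "0 < L (([:1, -1:] * w) * u * u)"
      proof (rule L_weight_square_pos[where b = "2 * b"])
        fix t :: real assume t: "-1 \<le> t" "t \<le> 1"
        have pt: "poly ([:1, -1:] * w) t = (1 - t) * poly w t" by (simp add: algebra_simps)
        show "0 \<le> poly ([:1, -1:] * w) t" unfolding pt using t w(1)[OF t] by simp
        show "poly ([:1, -1:] * w) t \<le> 2 * b"
          unfolding pt using t w(1)[OF t] w(2)[OF t] by (intro mult_mono) auto
      next
        show "[:1, -1:] * w \<noteq> 0" using w(3) by (simp del: mult_pCons_left)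
      qed (rule u0)
      then show ?thesis by (simp add: LN_def)
    qed
    have "[:1, -1:] * w * u * u = smult (1 - \<alpha> i) (w * u * u) - [:- \<alpha> i, 1:] * (w * u * u)"
      by (rule poly_eqI_real) (simp add: algebra_simps)
    then have "0 < (1 - \<alpha> i) * LN N (w * u * u)"
      using minus zero by (simp only: LN_diff LN_smult)
    then have "\<alpha> i < 1" using pos by (simp add: zero_less_mult_iff)
    moreover have "[:1, 1:] * w * u * u = smult (1 + \<alpha> i) (w * u * u) + [:- \<alpha> i, 1:] * (w * u * u)"
      by (rule poly_eqI_real) (simp add: algebra_simps)
    then have "0 < (1 + \<alpha> i) * LN N (w * u * u)"
      using plus[OF u0 du(1)] zero by (simp only: LN_add LN_smult)
    then have "-1 < \<alpha> i" using pos by (simp add: zero_less_mult_iff)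
    ultimately show ?thesis by simp
  qed
  moreover have "(\<Prod>i<s. [:- \<alpha> i, 1:]) \<in> pcone (range F)" if "s \<le> k" for s
  proof (rule pcone_trans[OF \<alpha>(3)[OF that]])
    \<comment> \<open>Only the top polynomial of \<open>p\<close> differs from a kernel;
      \<open>c \<ge> 0\<close> keeps it in the cone.\<close>
    have "F j \<in> pcone (range F)" for j by (rule pcone_base) (rule rangeI)
    then show "p ` {..k} \<subseteq> pcone (range F)"
      using c by (auto simp: p_def q_def intro: pcone_add pcone_smult)
  qed
  ultimately show ?thesis using that \<alpha>(1) LN_g unfolding g_def by blast
qed

end

text \<open>Interpolating doubly at each node, the Newton products are products of two partial products.\<close>

lemma prod_doubled:
  fixes \<alpha> :: "nat \<Rightarrow> real" and m :: nat
  shows "(\<Prod>j<m. [:- \<alpha> (j div 2), 1:]) =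
    (\<Prod>i<m div 2. [:- \<alpha> i, 1:]) * (\<Prod>i<(m + 1) div 2. [:- \<alpha> i, 1:])"
proof (induction m)
  case (Suc m)
  show ?case
  proof (cases "even m")
    case True
    then obtain l where "m = 2 * l" by blast
    then show ?thesis using Suc by (simp add: mult_ac del: mult_pCons_left mult_pCons_right)
  next
    case False
    then obtain l where "m = 2 * l + 1" by (blast elim: oddE)
    then show ?thesis using Suc by (simp add: mult_ac del: mult_pCons_left mult_pCons_right)
  qed
qed simp

subsection \<open>Universal lower bound spaces\<close>

lemma subspace_poly_space: "subspace_of_C (poly_space m)"
proof -
  have add: "\<exists>r. (\<lambda>t. poly p t + poly q t) = poly r \<and> degree r \<le> m" if "degree p \<le> m" "degree q \<le> m" for p q :: "real poly"
    using that by (intro exI[of _ "p + q"]) (auto intro: degree_add_le)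
  have smult: "\<exists>r. (\<lambda>t. a * poly p t) = poly r \<and> degree r \<le> m" if "degree p \<le> m" for p :: "real poly" and a
    using that by (intro exI[of _ "smult a p"]) (auto intro: order_trans[OF degree_smult_le])
  have zero: "\<exists>r. (\<lambda>t::real. 0) = poly r \<and> degree r \<le> m" by (intro exI[of _ 0]) auto
  show ?thesis
    unfolding subspace_of_C_def poly_space_def using add smult zero
    by (auto intro!: continuous_intros)
qed

text \<open>The sequence \<open>z\<close> lists the \<open>m + 1\<close> interpolation nodes with
  multiplicity. The cone condition on the partial products gives nonnegative expansion coefficients,
  and the sign of the full product puts the interpolant below \<open>h\<close>.\<close>

lemma ULB_spaceI:
  fixes z :: "nat \<Rightarrow> real"
  assumes n: "2 \<le> n"
    and Z: "finite Z" "Z \<subseteq> {-1..<1}" and \<rho>: "\<And>x. x \<in> Z \<Longrightarrow> 0 < \<rho> x"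
    and quad: "\<And>p. degree p \<le> m \<Longrightarrow> gegenbauer_int n p = poly p 1 / N + (\<Sum>x\<in>Z. \<rho> x * poly p x)"
    and z: "Z \<subseteq> z ` {..m}" "z ` {..m} \<subseteq> {-1..<1}"
    and nonneg: "\<And>t. -1 \<le> t \<Longrightarrow> t \<le> 1 \<Longrightarrow> 0 \<le> poly (\<Prod>j<Suc m. [:- z j, 1:]) t"
    and cone: "\<And>i. i \<le> m \<Longrightarrow> (\<Prod>j<i. [:- z j, 1:]) \<in> pcone (range (geg n))"
  shows "ULB_space n N (poly_space m)"
proof -
  define Q where "Q = map (\<lambda>x. (x, \<rho> x)) (sorted_list_of_set Z)"
  have set_Q: "set Q = (\<lambda>x. (x, \<rho> x)) ` Z" using Z by (simp add: Q_def)
  have sum_Q: "(\<Sum>(\<alpha>, \<rho>)\<leftarrow>Q. \<rho> * f \<alpha>) = (\<Sum>x\<in>Z. \<rho> x * f x)" for f :: "real \<Rightarrow> real"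
    using Z by (simp add: Q_def o_def sum_list_distinct_conv_sum_set)
  have "quadrature_rule n N (poly_space m) Q"
    unfolding quadrature_rule_def
  proof (intro conjI)
    show "sorted_wrt (<) (map fst Q)" by (simp add: Q_def o_def)
    show "\<forall>(\<alpha>, \<rho>)\<in>set Q. -1 \<le> \<alpha> \<and> \<alpha> < 1 \<and> \<rho> > 0"
      using Z \<rho> by (auto simp: set_Q)
    show "\<forall>f\<in>poly_space m. (LINT t|gegenbauer_measure n. f t) = f 1 / N + (\<Sum>(\<alpha>, \<rho>)\<leftarrow>Q. \<rho> * f \<alpha>)"
      unfolding sum_Q using quad by (auto simp: poly_space_def gegenbauer_int_def)
  qed
  moreover have "\<exists>f\<in>poly_space m \<inter> admissible n h. \<forall>(\<alpha>, \<rho>)\<in>set Q. ereal (f \<alpha>) = h \<alpha>"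
    if h: "absolutely_monotone h" for h
  proof -
    obtain d where d: "am_derivs d" "\<And>t. t \<in> {-1..<1} \<Longrightarrow> h t = ereal (d 0 t)"
      using h unfolding absolutely_monotone_def am_derivs_def by blast
    have lim: "(h \<longlongrightarrow> h 1) (at_left 1)" using h by (simp add: absolutely_monotone_def)
    have "\<exists>a R. (\<forall>i. 0 \<le> a i) \<and> (\<forall>t\<in>{-1..<1}. 0 \<le> R t \<and>
        d 0 t = (\<Sum>i<Suc m. a i * (\<Prod>j<i. t - z j)) + R t * (\<Prod>j<Suc m. t - z j))"
    proof (rule am_newton[OF d(1)])
      show "z i \<in> {-1..<1}" if "i < Suc m" for i
        using z(2) that by (auto simp: image_subset_iff less_Suc_eq_le)
    qed
    then obtain a R where "(\<forall>i. 0 \<le> a i) \<and> (\<forall>t\<in>{-1..<1}. 0 \<le> R t \<and>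
        d 0 t = (\<Sum>i<Suc m. a i * (\<Prod>j<i. t - z j)) + R t * (\<Prod>j<Suc m. t - z j))"
      by (elim exE)
    then have aR: "\<And>i. 0 \<le> a i" "\<And>t. t \<in> {-1..<1} \<Longrightarrow> 0 \<le> R t"
      "\<And>t. t \<in> {-1..<1} \<Longrightarrow>
        d 0 t = (\<Sum>i<Suc m. a i * (\<Prod>j<i. t - z j)) + R t * (\<Prod>j<Suc m. t - z j)"
      by blast+
    define p where "p = (\<Sum>i<Suc m. smult (a i) (\<Prod>j<i. [:- z j, 1:]))"
    have poly_z: "poly (\<Prod>j<i. [:- z j, 1:]) t = (\<Prod>j<i. t - z j)" for i t
      by (simp add: poly_prod)
    have d_eq: "d 0 t = poly p t + R t * poly (\<Prod>j<Suc m. [:- z j, 1:]) t" if "t \<in> {-1..<1}" for t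
      unfolding p_def poly_sum poly_smult poly_z aR(3)[OF that] ..
    have "degree (smult (a i) (\<Prod>j<i. [:- z j, 1:])) \<le> m" if "i < Suc m" for i
      using that by (intro order_trans[OF degree_smult_le]) (simp add: degree_prod_eq_sum_degree)
    then have "degree p \<le> m" unfolding p_def by (intro degree_sum_le) auto
    then have mem: "poly p \<in> poly_space m" by (auto simp: poly_space_def)
    have "p \<in> pcone (range (geg n))"
      unfolding p_def using aR(1) cone by (intro pcone_sum pcone_smult) auto
    from pcone_range_sum[OF this] obtain c l where
      c: "\<forall>i. 0 \<le> c i" "p = (\<Sum>i<l. smult (c i) (geg n i))"
      by (elim exE conjE) (rule that)
    have sums: "(\<lambda>i. (if i < l then c i else 0) * poly (gegenbauer n i) t) sums poly p t" for t
    proof -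
      have "(\<lambda>i. (if i < l then c i else 0) * poly (gegenbauer n i) t) sums
          (\<Sum>i<l. (if i < l then c i else 0) * poly (gegenbauer n i) t)"
        by (rule sums_finite) auto
      then show ?thesis by (simp add: c(2) poly_sum gegenbauer_eq_geg[OF n])
    qed
    have le: "ereal (poly p t) \<le> h t" if "t \<in> {-1..<1}" for t
      using d_eq[OF that] d(2)[OF that] aR(2)[OF that] nonneg[of t] that by simp
    \<comment> \<open>The Newton formula stops short of 1, where \<open>h\<close> may be infinite,
      so the inequality is passed to the left limit.\<close>
    have "ereal (poly p 1) \<le> h 1"
    proof (rule tendsto_le[OF trivial_limit_at_left_real lim])
      have "((\<lambda>t. poly p t) \<longlongrightarrow> poly p 1) (at_left 1)"
        by (intro tendsto_intros)
      then show "((\<lambda>t. ereal (poly p t)) \<longlongrightarrow> ereal (poly p 1)) (at_left 1)"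
        by (intro tendsto_ereal)
      have "\<forall>\<^sub>F t in at_left 1. t \<in> {-1<..<1::real}"
        by (rule eventually_at_left_real) simp
      then show "\<forall>\<^sub>F t in at_left 1. ereal (poly p t) \<le> h t"
        by eventually_elim (auto intro: le)
    qed
    then have le': "ereal (poly p t) \<le> h t" if "t \<in> {-1..1}" for t
      using le[of t] that by (cases "t = 1") auto
    have "poly p \<in> admissible n h"
      unfolding admissible_def using sums c(1) le'
      by (auto intro!: continuous_intros exI[of _ "\<lambda>i. if i < l then c i else 0"])
    moreover have "ereal (poly p x) = h x" if x: "x \<in> Z" for x
    proof -
      obtain i where i: "i < Suc m" "x = z i" using z(1) x by (auto simp: less_Suc_eq_le)
      then have "poly (\<Prod>j<Suc m. [:- z j, 1:]) x = 0"
        unfolding poly_z by (intro prod_zero) auto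
      then show ?thesis using d_eq[of x] d(2)[of x] Z(2) x by auto
    qed
    ultimately show ?thesis
      using mem by (intro bexI[of _ "poly p"]) (auto simp: set_Q)
  qed
  ultimately show ?thesis
    unfolding ULB_space_def using subspace_poly_space by blast
qed

text \<open>A polynomial vanishing at all other nodes isolates one weight.\<close>

lemma positive_weight:
  fixes \<rho> :: "real \<Rightarrow> real"
  assumes "finite Z" "z \<in> Z" "0 < (\<Sum>x\<in>Z. \<rho> x * poly f x)"
    and "\<And>x. x \<in> Z \<Longrightarrow> x \<noteq> z \<Longrightarrow> poly f x = 0" and "0 \<le> poly f z"
  shows "0 < \<rho> z"
proof -
  have "(\<Sum>x\<in>Z. \<rho> x * poly f x) = (\<Sum>x\<in>Z. if x = z then \<rho> z * poly f z else 0)"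
    using assms(4) by (intro sum.cong) auto
  then have "0 < \<rho> z * poly f z" using assms by simp
  then show ?thesis using assms(5) by (simp add: zero_less_mult_iff)
qed

section \<open>Positivity thresholds and the Delsarte--Goethals--Seidel bound\<close>

context gegenbauer_functional
begin

abbreviation "T j \<equiv> real ((n + j - 1) choose (n - 1))"

lemma T_pos: "0 < T j"
  using n2 by (simp add: zero_less_binomial_iff)

lemma T_mono: "i \<le> j \<Longrightarrow> T i \<le> T j"
  by (intro of_nat_mono binomial_right_mono) simp

lemma K_1: "poly (K j) 1 = T j + (if j = 0 then 0 else T (j - 1))"
  unfolding K_def poly_add E_1 by (auto simp: E_1)

text \<open>For \<open>0 < m\<close> the threshold is \<open>DGS_bound n (2 * m)\<close>; the one in
  \<open>LN_pos_E\<close> is \<open>DGS_bound n (2 * m + 1)\<close>. They are the weights 1 and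
  \<open>1 + t\<close> in \<open>LN_square_pos\<close>.\<close>

lemma LN_pos_K:
  assumes "poly (K m) 1 < N" "u \<noteq> 0" "degree u \<le> m"
  shows "0 < LN N (u * u)"
proof -
  have "0 < poly (K m) 1"
    unfolding K_1 using T_pos by (simp add: add_pos_nonneg)
  then have "0 < LN N (1 * u * u)"
    using assms K_reproducing degree_K[of m]
    by (intro LN_square_pos[where F = "K m" and m = m and b = 1]) auto
  then show ?thesis by simp
qed

lemma LN_pos_E:
  assumes "2 * T m < N" "u \<noteq> 0" "degree u \<le> m"
  shows "0 < LN N ([:1, 1:] * u * u)"
proof (rule LN_square_pos[where F = "E m" and m = m and b = 2])
  show "L ([:1, 1:] * E m * v) = poly v 1" if "degree v \<le> m" for v
    using E_reproducing[OF that] .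
  show "0 < N" using assms(1) T_pos[of m] by simp
qed (use assms T_pos degree_E[of m] E_1[of m] in auto)

end

lemma DGS_bound_eq:
  assumes "2 \<le> n" "0 < k"
  shows "DGS_bound n (2 * k - 1) = 2 * ((n + (k - 1) - 1) choose (n - 1))"
    and "DGS_bound n (2 * k) = ((n + k - 1) choose (n - 1)) + ((n + (k - 1) - 1) choose (n - 1))"
proof -
  obtain l where l: "k = Suc l" using assms(2) by (cases k) auto
  obtain q where "n = 2 + q" using le_Suc_ex[OF assms(1)] by blast
  then have q: "n = Suc (Suc q)" by simp
  have "Suc (2 * k - 1) = 2 * k" using assms(2) by simp
  then show "DGS_bound n (2 * k - 1) = 2 * ((n + (k - 1) - 1) choose (n - 1))"
    unfolding DGS_bound_def Let_def by (simp add: l q)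
  show "DGS_bound n (2 * k) = ((n + k - 1) choose (n - 1)) + ((n + (k - 1) - 1) choose (n - 1))"
    unfolding DGS_bound_def Let_def by (simp add: l q)
qed

text \<open>Weight 1 and kernel \<open>K\<close>. All \<open>k\<close> nodes are interior and
  interpolated doubly, so the full Newton product is a square and each partial product is a product
  of two elements of the cone of \<open>E\<close>.\<close>

lemma ULB_space_odd:
  assumes n: "2 \<le> n" and k: "0 < k"
    and N: "real (DGS_bound n (2 * k - 1)) < N" "N \<le> real (DGS_bound n (2 * k))"
  shows "ULB_space n N (poly_space (2 * k - 1))"
proof -
  interpret gegenbauer_functional n "gegenbauer_int n" by (rule gegenbauer_functional_int[OF n])
  have N2: "2 * T (k - 1) < N" and Nle: "N \<le> T k + T (k - 1)"
    using N unfolding DGS_bound_eq[OF n k] by simp_all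
  have N1: "poly (K (k - 1)) 1 < N"
    unfolding K_1 using N2 T_pos[of "k - 1"] T_mono[OF diff_le_self, of "k - 1" 1] by (cases "k - 1 = 0") auto
  have N0: "0 < N" using N2 T_pos[of "k - 1"] by simp
  obtain \<alpha> where \<alpha>: "strict_mono_on {..<k} \<alpha>" "\<And>i. i < k \<Longrightarrow> -1 < \<alpha> i \<and> \<alpha> i < 1"
      "\<And>v. degree v < k \<Longrightarrow> LN N (1 * (\<Prod>i<k. [:- \<alpha> i, 1:]) * v) = 0"
      "\<And>s. s \<le> k \<Longrightarrow> (\<Prod>i<s. [:- \<alpha> i, 1:]) \<in> pcone (range K)"
  proof (rule gauss_nodes[OF jacobi_K k, of 1 1 N])
    show "0 < poly (K j) 1" for j
      unfolding K_1 using T_pos by (simp add: add_pos_nonneg)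
    \<comment> \<open>This use of the lower bound on \<open>N\<close> keeps the nodes to the right
      of -1.\<close>
    show "0 < LN N ([:1, 1:] * 1 * u * u)" if "u \<noteq> 0" "degree u < k" for u
      using LN_pos_E[OF N2 that(1)] that(2) by simp
    show "N \<le> poly 1 1 * poly (K k) 1"
      unfolding K_1 using Nle k by simp
  qed (use K_reproducing N1 N0 in auto)
  define Z where "Z = \<alpha> ` {..<k}"
  have inj: "inj_on \<alpha> {..<k}" using \<alpha>(1) by (rule strict_mono_on_imp_inj_on)
  have Z: "finite Z" "card Z = k" "Z \<subseteq> {-1<..<1}"
    using inj \<alpha>(2) by (auto simp: Z_def card_image)
  have prod_Z: "(\<Prod>x\<in>Z. [:- x, 1:]) = (\<Prod>i<k. [:- \<alpha> i, 1:])"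
    unfolding Z_def by (subst prod.reindex[OF inj]) simp
  obtain \<rho> where \<rho>: "\<And>f. degree f \<le> 2 * k - 1 \<Longrightarrow> LN N f = (\<Sum>x\<in>Z. \<rho> x * poly f x)"
  proof -
    have "\<exists>\<rho>. \<forall>f. degree f \<le> 2 * k - 1 \<longrightarrow> LN N f = (\<Sum>x\<in>Z. \<rho> x * poly f x)"
    proof (rule lagrange_functional[OF LN_add LN_smult Z(1)])
      show "card Z \<le> 2 * k - 1" using Z(2) k by simp
      show "LN N ((\<Prod>x\<in>Z. [:- x, 1:]) * v) = 0" if "degree v + card Z \<le> 2 * k - 1" for v
        using \<alpha>(3)[of v] that Z(2) k unfolding prod_Z by simp
    qed
    then show ?thesis using that by blast
  qed
  show ?thesis
  proof (rule ULB_spaceI[OF n Z(1), where \<rho> = \<rho> and z = "\<lambda>i. \<alpha> (i div 2)"])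
    show "Z \<subseteq> {-1..<1}" using Z(3) by auto
    show "0 < \<rho> x" if x: "x \<in> Z" for x
    proof -
      define u where "u = (\<Prod>y\<in>Z - {x}. [:- y, 1:])"
      have u: "u \<noteq> 0" "degree u = k - 1"
        using prod_linear[of "Z - {x}"] Z(1,2) x by (auto simp: u_def)
      have "0 < LN N (u * u)" using LN_pos_K[OF N1 u(1)] u(2) by simp
      also have "degree (u * u) \<le> 2 * k - 1"
        using degree_mult_le[of u u] u(2) k by simp
      note \<rho>[OF this]
      finally show ?thesis
        using Z(1) x by (intro positive_weight[of Z x \<rho> "u * u"]) (auto simp: u_def poly_prod prod_zero_iff)
    qed
    show "gegenbauer_int n p = poly p 1 / N + (\<Sum>x\<in>Z. \<rho> x * poly p x)" if "degree p \<le> 2 * k - 1" for p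
      using \<rho>[OF that] by (simp add: LN_def)
    show "Z \<subseteq> (\<lambda>i. \<alpha> (i div 2)) ` {..2 * k - 1}"
    proof
      fix x assume "x \<in> Z"
      then obtain i where "i < k" "x = \<alpha> i" by (auto simp: Z_def)
      then show "x \<in> (\<lambda>i. \<alpha> (i div 2)) ` {..2 * k - 1}"
        by (intro image_eqI[of _ _ "2 * i"]) auto
    qed
    have div_less: "i div 2 < k" if "i \<le> 2 * k - 1" for i
      using that k by linarith
    show "(\<lambda>i. \<alpha> (i div 2)) ` {..2 * k - 1} \<subseteq> {-1..<1}"
    proof (intro image_subsetI)
      fix i assume "i \<in> {..2 * k - 1}"
      then show "\<alpha> (i div 2) \<in> {-1..<1}" using \<alpha>(2)[OF div_less[of i]] by simp
    qed
    show "0 \<le> poly (\<Prod>j<Suc (2 * k - 1). [:- \<alpha> (j div 2), 1:]) t" for t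
      unfolding prod_doubled using k by simp
    show "(\<Prod>j<i. [:- \<alpha> (j div 2), 1:]) \<in> pcone (range P)" if i: "i \<le> 2 * k - 1" for i
    proof -
      have "(\<Prod>i<s. [:- \<alpha> i, 1:]) \<in> pcone (range E)" if "s \<le> k" for s
        using \<alpha>(4)[OF that] K_cone_E by (auto intro: pcone_trans)
      then show ?thesis
        unfolding prod_doubled using i k by (intro cone_E_imp_cone_P mult_cone_E) auto
    qed
  qed
qed

text \<open>Weight \<open>1 + t\<close> and kernel \<open>E\<close>. The node -1 is simple and the
  \<open>k\<close> interior nodes are double, which makes \<open>2 * k + 1\<close> conditions; the
  full Newton product is \<open>1 + t\<close> times a square.\<close>

lemma ULB_space_even:
  assumes n: "2 \<le> n" and k: "0 < k"
    and N: "real (DGS_bound n (2 * k)) < N" "N \<le> real (DGS_bound n (2 * k + 1))"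
  shows "ULB_space n N (poly_space (2 * k))"
proof -
  interpret gegenbauer_functional n "gegenbauer_int n" by (rule gegenbauer_functional_int[OF n])
  have K_less: "T k + T (k - 1) < N" using N unfolding DGS_bound_eq[OF n k] by simp
  have N1: "poly (K k) 1 < N" unfolding K_1 using K_less k by simp
  have N2: "2 * T (k - 1) < N" using K_less T_mono[of "k - 1" k] by simp
  have Nle: "N \<le> 2 * T k"
    using N(2) DGS_bound_eq(1)[OF n, of "Suc k"] by simp
  have N0: "0 < N" using N2 T_pos[of "k - 1"] by simp
  obtain \<alpha> where \<alpha>: "strict_mono_on {..<k} \<alpha>" "\<And>i. i < k \<Longrightarrow> -1 < \<alpha> i \<and> \<alpha> i < 1"
      "\<And>v. degree v < k \<Longrightarrow> LN N ([:1, 1:] * (\<Prod>i<k. [:- \<alpha> i, 1:]) * v) = 0"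
      "\<And>s. s \<le> k \<Longrightarrow> (\<Prod>i<s. [:- \<alpha> i, 1:]) \<in> pcone (range E)"
  proof (rule gauss_nodes[OF jacobi_E k, of "[:1, 1:]" 2 N])
    \<comment> \<open>The extra factor completes the weight to the square of \<open>1 + t\<close>,
      so positivity for squares of degree up to \<open>k\<close> in the weight 1 suffices.\<close>
    show "0 < LN N ([:1, 1:] * [:1, 1:] * u * u)" if u: "u \<noteq> 0" "degree u < k" for u
    proof -
      have "degree ([:1, 1:] * u) \<le> k"
        using degree_mult_le[of "[:1, 1:]" u] u(2) by simp
      then have "0 < LN N (([:1, 1:] * u) * ([:1, 1:] * u))"
        using u(1) by (intro LN_pos_K[OF N1]) (simp_all del: mult_pCons_left)
      then show ?thesis by (simp only: mult_ac)
    qed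
    show "gegenbauer_int n ([:1, 1:] * E j * v) = poly v 1" if "degree v \<le> j" for j v
      using E_reproducing[OF that] .
    show "0 < poly (E j) 1" for j unfolding E_1 by (rule T_pos)
    show "poly [:1, 1:] 1 * poly (E (k - 1)) 1 < N" unfolding E_1 using N2 by simp
    show "N \<le> poly [:1, 1:] 1 * poly (E k) 1" unfolding E_1 using Nle by simp
  qed (use N0 in auto)
  define Y where "Y = \<alpha> ` {..<k}"
  have inj: "inj_on \<alpha> {..<k}" using \<alpha>(1) by (rule strict_mono_on_imp_inj_on)
  have Y: "finite Y" "card Y = k" "Y \<subseteq> {-1<..<1}"
    using inj \<alpha>(2) by (auto simp: Y_def card_image)
  define Z where "Z = insert (-1) Y"
  have "-1 \<notin> Y" using Y(3) by auto
  then have Z: "finite Z" "card Z = Suc k" "-1 \<notin> Y"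
    using Y(1,2) by (auto simp: Z_def)
  define g where "g = (\<Prod>x\<in>Y. [:- x, 1:])"
  have g: "g = (\<Prod>i<k. [:- \<alpha> i, 1:])" "degree g = k" "g \<noteq> 0"
    unfolding g_def using prod_linear[OF Y(1)] Y(2) inj by (auto simp: Y_def prod.reindex)
  have prod_Z: "(\<Prod>x\<in>Z. [:- x, 1:]) = [:1, 1:] * g"
    using Z(3) Y(1) by (simp add: Z_def g_def)
  obtain \<rho> where \<rho>: "\<And>f. degree f \<le> 2 * k \<Longrightarrow> LN N f = (\<Sum>x\<in>Z. \<rho> x * poly f x)"
  proof -
    have "\<exists>\<rho>. \<forall>f. degree f \<le> 2 * k \<longrightarrow> LN N f = (\<Sum>x\<in>Z. \<rho> x * poly f x)"
    proof (rule lagrange_functional[OF LN_add LN_smult Z(1)])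
      show "card Z \<le> 2 * k" using Z(2) k by simp
      show "LN N ((\<Prod>x\<in>Z. [:- x, 1:]) * v) = 0" if "degree v + card Z \<le> 2 * k" for v
        unfolding prod_Z g(1) using that Z(2) by (intro \<alpha>(3)) simp
    qed
    then show ?thesis using that by blast
  qed
  \<comment> \<open>Putting -1 first gives every nonempty partial product the factor
    \<open>1 + t\<close>, next to a doubled product as in the odd case.\<close>
  define z where "z = case_nat (-1) (\<lambda>i. \<alpha> (i div 2))"
  have prod_z: "(\<Prod>j<Suc i. [:- z j, 1:]) =
      [:1, 1:] * ((\<Prod>i<i div 2. [:- \<alpha> i, 1:]) * (\<Prod>i<(i + 1) div 2. [:- \<alpha> i, 1:]))" for i
    unfolding prod.lessThan_Suc_shift by (simp add: z_def prod_doubled del: mult_pCons_left)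
  show ?thesis
  proof (rule ULB_spaceI[OF n Z(1), where \<rho> = \<rho> and z = z])
    show "Z \<subseteq> {-1..<1}" using Y(3) by (auto simp: Z_def)
    show "0 < \<rho> x" if x: "x \<in> Z" for x
    proof (cases "x = -1")
      case True
      \<comment> \<open>The weight at -1 is tested with the square of the interior node polynomial,
        whose degree \<open>2 * k\<close> is the largest for which the rule is exact.\<close>
      have "0 < LN N (g * g)" using LN_pos_K[OF N1 g(3)] g(2) by simp
      also have "degree (g * g) \<le> 2 * k"
        using degree_mult_le[of g g] g(2) by simp
      note \<rho>[OF this]
      finally show ?thesis
        using Z(1) x True Y(1)
        by (intro positive_weight[of Z x \<rho> "g * g"]) (auto simp: Z_def g_def poly_prod prod_zero_iff)
    next
      case False
      then have xY: "x \<in> Y" using x by (simp add: Z_def)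
      define u where "u = (\<Prod>y\<in>Y - {x}. [:- y, 1:])"
      have u: "u \<noteq> 0" "degree u = k - 1"
        using prod_linear[of "Y - {x}"] Y(1,2) xY by (auto simp: u_def)
      have "0 < LN N ([:1, 1:] * u * u)" using LN_pos_E[OF N2 u(1)] u(2) by simp
      also have "degree ([:1, 1:] * u * u) \<le> 2 * k"
        using degree_mult_le[of "[:1, 1:] * u" u] degree_mult_le[of "[:1, 1:]" u] u(2) k by simp
      note \<rho>[OF this]
      finally have pos: "0 < (\<Sum>x\<in>Z. \<rho> x * poly ([:1, 1:] * u * u) x)" .
      have eval: "poly ([:1, 1:] * u * u) y = (1 + y) * (poly u y * poly u y)" for y
        by (simp add: algebra_simps)
      show ?thesis
      proof (rule positive_weight[OF Z(1) x pos])
        show "poly ([:1, 1:] * u * u) y = 0" if "y \<in> Z" "y \<noteq> x" for y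
          unfolding eval using that Y(1) by (auto simp: Z_def u_def poly_prod prod_zero_iff)
        show "0 \<le> poly ([:1, 1:] * u * u) x"
          unfolding eval using Y(3) xY by (intro mult_nonneg_nonneg zero_le_square) auto
      qed
    qed
    show "gegenbauer_int n p = poly p 1 / N + (\<Sum>x\<in>Z. \<rho> x * poly p x)" if "degree p \<le> 2 * k" for p
      using \<rho>[OF that] by (simp add: LN_def)
    show "Z \<subseteq> z ` {..2 * k}"
    proof
      fix x assume "x \<in> Z"
      then consider "x = -1" | i where "i < k" "x = \<alpha> i" by (auto simp: Z_def Y_def)
      then show "x \<in> z ` {..2 * k}"
      proof cases
        case 1
        then show ?thesis by (intro image_eqI[of _ _ 0]) (auto simp: z_def)
      next
        case 2
        then show ?thesis by (intro image_eqI[of _ _ "Suc (2 * i)"]) (auto simp: z_def)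
      qed
    qed
    show "z ` {..2 * k} \<subseteq> {-1..<1}"
    proof (intro image_subsetI)
      fix i assume i: "i \<in> {..2 * k}"
      show "z i \<in> {-1..<1}"
      proof (cases i)
        case (Suc j)
        then have "j div 2 < k" using i k by auto
        then show ?thesis using \<alpha>(2)[of "j div 2"] Suc by (simp add: z_def)
      qed (simp add: z_def)
    qed
    show "0 \<le> poly (\<Prod>j<Suc (2 * k). [:- z j, 1:]) t" if "-1 \<le> t" for t
    proof -
      have "poly (\<Prod>j<Suc (2 * k). [:- z j, 1:]) t = (1 + t) * (poly g t * poly g t)"
        unfolding prod_z g(1) by (simp add: algebra_simps)
      then show ?thesis using that by simp
    qed
    show "(\<Prod>j<i. [:- z j, 1:]) \<in> pcone (range P)" if i: "i \<le> 2 * k" for i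
    proof (cases i)
      case 0
      then show ?thesis using pcone_base[OF rangeI, of P 0] by simp
    next
      case (Suc j)
      then show ?thesis
        unfolding Suc prod_z using i Suc
        by (intro mult_1_X_cone cone_E_imp_cone_P mult_cone_E \<alpha>(4)) auto
    qed
  qed
qed

theorem theorem2p9:
  fixes n \<tau> :: nat and N :: real
  assumes "n \<ge> 2" and "\<tau> \<ge> 1"
    and "N \<in> {real (DGS_bound n \<tau>)<..real (DGS_bound n (\<tau> + 1))}"
  shows "ULB_space n N (poly_space \<tau>)"
proof (cases "even \<tau>")
  case True
  then obtain k where k: "\<tau> = 2 * k" by blast
  then show ?thesis using assms by (intro ULB_space_even[of n k N, folded k]) auto
next
  case False
  then obtain k where k: "\<tau> = 2 * (k + 1) - 1" by (auto elim: oddE)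
  then show ?thesis using assms ULB_space_odd[of n "k + 1" N] by simp
qed

end
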